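(* Let $F\colon\mathscr{P}_2(\mathbb{R}^d)\to\mathbb{R}$ and let $\lambda\in\mathbb{R}$. If $F$ is differentiable on $\mathscr{P}_2(\mathbb{R}^d)$ (i.e. differentiable at every $\mu\in\mathscr{P}_2(\mathbb{R}^d)$), then the following statements are equivalent. 1. $F$ is $\lambda$-geodesically convex. 2. $F$ is $\lambda$-convex along generalised geodesics. 3. $F$ is $\lambda$-convex along acceleration-free curves.
   Context: $\mathscr{P}_2(\mathbb{R}^d)$ is the set of Borel probability measures on $\mathbb{R}^d$ with finite second moment, endowed with the $2$-Wasserstein distance $W_2(\mu,\nu)=\inf\{(\int|x_1-x_2|^2\,d\gamma(x_1,x_2))^{1/2}:\gamma\in\Gamma(\mu,\nu)\}$, where $\Gamma(\mu,\nu)$ is the set of $\gamma\in\mathscr{P}_2(\mathbb{R}^d\times\mathbb{R}^d)$ with first marginal $\mu$ and second marginal $\nu$. $\Gamma_o(\mu,\nu)\subset\Gamma(\mu,\nu)$ is the set of optimal plans, i.e. those $\gamma$ with $\int|x_1-x_2|^2\,d\gamma=W_2^2(\mu,\nu)$. $\pi^k$ denotes projection on the $k$-th $\mathbb{R}^d$-factor, $\pi^{i,j}(x_1,x_2,x_3)=(x_i,x_j)$, and $T_{\#}\mu$ is the pushforward. Differentiability: for $\mu\in\mathscr{P}_2(\mathbb{R}^d)$ and $\xi\in L^2(\mu;\mathbb{R}^d)$, write $\xi\in\partial F[\mu]$ if $F(\nu)-F(\mu)=\int\xi(x_1)\cdot(x_2-x_1)\,d\gamma(x_1,x_2)+o(W_2(\mu,\nu))$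 for all $\nu\in\mathscr{P}_2(\mathbb{R}^d)$ and all $\gamma\in\Gamma_o(\mu,\nu)$ (that is, for every $\epsilon>0$ there is $\delta>0$ such that the error is at most $\epsilon W_2(\mu,\nu)$ in absolute value for all $\nu$ with $W_2(\mu,\nu)<\delta$ and all $\gamma\in\Gamma_o(\mu,\nu)$). $F$ is differentiable at $\mu$ if $\partial F[\mu]\neq\varnothing$. $\lambda$-geodesic convexity: a curve $[0,1]\ni t\mapsto\mu_t$ is a geodesic between $\mu_1$ and $\mu_2$ (its endpoints at $t=0$ and $t=1$ respectively) if $\mu_t=((1-t)\pi^1+t\pi^2)_{\#}\gamma$ for all $t\in[0,1]$, for some $\gamma\in\Gamma_o(\mu_1,\mu_2)$. $F$ is $\lambda$-geodesically convex if between every pair $\mu_1,\mu_2\in\mathscr{P}_2(\mathbb{R}^d)$ there exists a geodesic $t\mapsto\mu_t$ such that $F(\mu_t)\le(1-t)F(\mu_1)+tF(\mu_2)-\frac{\lambda}{2}t(1-t)W_2^2(\mu_1,\mu_2)$ for all $t\in[0,1]$. $\lambda$-convexity along generalised geodesics: for every triplet $\mu_1,\mu_2,\mu_3\in\mathscr{P}_2(\mathbb{R}^d)$ there exists $\boldsymbol{\mu}\in\mathscr{P}_2((\mathbb{R}^d)^3)$ with $\pi^{1,2}_{\#}\boldsymbol{\mu}\in\Gamma_o(\mu_1,\mu_2)$ and $\pi^{1,3}_{\#}\boldsymbol{\mu}\in\Gamma_o(\mu_1,\mu_3)$ such that the curve $\mu_t:=((1-t)\pi^2+t\pi^3)_{\#}\boldsymbol{\mu}$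 satisfies $F(\mu_t)\le(1-t)F(\mu_2)+tF(\mu_3)-\frac{\lambda}{2}t(1-t)\int|x_2-x_3|^2\,d\boldsymbol{\mu}(x_1,x_2,x_3)$ for all $t\in[0,1]$. $\lambda$-convexity along acceleration-free curves: for every pair $\mu_1,\mu_2\in\mathscr{P}_2(\mathbb{R}^d)$, every $\gamma\in\Gamma(\mu_1,\mu_2)$ (not necessarily optimal) and every $t\in[0,1]$, $F(((1-t)\pi^1+t\pi^2)_{\#}\gamma)\le(1-t)F(\mu_1)+tF(\mu_2)-\frac{\lambda}{2}t(1-t)\int|x_1-x_2|^2\,d\gamma(x_1,x_2)$. *)

theory Defs
  imports "HOL-Probability.Probability"
begin

text \<open>Definitions are given for a general Euclidean space \<open>'a\<close>, so that \<open>P2\<close> also applies to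
  \<open>'a \<times> 'a\<close> and \<open>'a \<times> 'a \<times> 'a\<close>, whose library norms are the Euclidean product norms.\<close>

definition P2 :: "'a::euclidean_space measure set" where
  "P2 = {\<mu>. prob_space \<mu> \<and> sets \<mu> = sets borel \<and> integrable \<mu> (\<lambda>x. (norm x)\<^sup>2)}"

definition plans ::
  "'a::euclidean_space measure \<Rightarrow> 'a measure \<Rightarrow> ('a \<times> 'a) measure set" where
  "plans \<mu> \<nu> = {\<gamma> \<in> P2. distr \<gamma> borel fst = \<mu> \<and> distr \<gamma> borel snd = \<nu>}"

text \<open>For \<open>\<mu>, \<nu> \<in> P2\<close> the infimum below is over a nonempty set of nonnegative reals, and all the
  integrands are integrable because plans have finite second moment.\<close>

definition W2 :: "'a::euclidean_space measure \<Rightarrow> 'a measure \<Rightarrow> real" where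
  "W2 \<mu> \<nu> = (INF \<gamma> \<in> plans \<mu> \<nu>. sqrt (\<integral>(x1, x2). (norm (x1 - x2))\<^sup>2 \<partial>\<gamma>))"

definition opt_plans ::
  "'a::euclidean_space measure \<Rightarrow> 'a measure \<Rightarrow> ('a \<times> 'a) measure set" where
  "opt_plans \<mu> \<nu> =
     {\<gamma> \<in> plans \<mu> \<nu>. (\<integral>(x1, x2). (norm (x1 - x2))\<^sup>2 \<partial>\<gamma>) = (W2 \<mu> \<nu>)\<^sup>2}"

text \<open>Elements of \<open>L\<^sup>2(\<mu>; 'a)\<close> are represented by square-integrable functions rather than by
  equivalence classes of them.\<close>

definition L2 :: "'a::euclidean_space measure \<Rightarrow> ('a \<Rightarrow> 'a) set" where
  "L2 \<mu> = {\<xi> \<in> borel_measurable \<mu>. integrable \<mu> (\<lambda>x. (norm (\<xi> x))\<^sup>2)}"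

text \<open>A functional on \<open>P2\<close> is a real function on all measures whose values outside \<open>P2\<close> are
  never used.\<close>

definition W2_diff :: "('a::euclidean_space measure \<Rightarrow> real) \<Rightarrow> 'a measure \<Rightarrow> ('a \<Rightarrow> 'a) set" where
  "W2_diff F \<mu> = {\<xi> \<in> L2 \<mu>. \<forall>\<epsilon>>0. \<exists>\<delta>>0. \<forall>\<nu>\<in>P2. W2 \<mu> \<nu> < \<delta> \<longrightarrow>
     (\<forall>\<gamma>\<in>opt_plans \<mu> \<nu>.
        \<bar>F \<nu> - F \<mu> - (\<integral>(x1, x2). \<xi> x1 \<bullet> (x2 - x1) \<partial>\<gamma>)\<bar> \<le> \<epsilon> * W2 \<mu> \<nu>)}"

definition W2_differentiable :: "('a::euclidean_space measure \<Rightarrow> real) \<Rightarrow> 'a measure \<Rightarrow> bool" where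
  "W2_differentiable F \<mu> \<longleftrightarrow> W2_diff F \<mu> \<noteq> {}"

definition geodesic_between ::
  "'a::euclidean_space measure \<Rightarrow> 'a measure \<Rightarrow> (real \<Rightarrow> 'a measure) \<Rightarrow> bool" where
  "geodesic_between \<mu>1 \<mu>2 m \<longleftrightarrow> (\<exists>\<gamma>\<in>opt_plans \<mu>1 \<mu>2. \<forall>t\<in>{0..1}.
     m t = distr \<gamma> borel (\<lambda>(x1, x2). (1 - t) *\<^sub>R x1 + t *\<^sub>R x2))"

definition geodesically_convex :: "real \<Rightarrow> ('a::euclidean_space measure \<Rightarrow> real) \<Rightarrow> bool" where
  "geodesically_convex l F \<longleftrightarrow> (\<forall>\<mu>1\<in>P2. \<forall>\<mu>2\<in>P2. \<exists>m. geodesic_between \<mu>1 \<mu>2 m \<and>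
     (\<forall>t\<in>{0..1}. F (m t) \<le> (1 - t) * F \<mu>1 + t * F \<mu>2 - l / 2 * t * (1 - t) * (W2 \<mu>1 \<mu>2)\<^sup>2))"

definition generalised_geodesically_convex ::
  "real \<Rightarrow> ('a::euclidean_space measure \<Rightarrow> real) \<Rightarrow> bool" where
  "generalised_geodesically_convex l F \<longleftrightarrow>
     (\<forall>\<mu>1\<in>P2. \<forall>\<mu>2\<in>P2. \<forall>\<mu>3\<in>P2. \<exists>M \<in> (P2 :: ('a \<times> 'a \<times> 'a) measure set).
        distr M borel (\<lambda>(x1, x2, x3). (x1, x2)) \<in> opt_plans \<mu>1 \<mu>2 \<and>
        distr M borel (\<lambda>(x1, x2, x3). (x1, x3)) \<in> opt_plans \<mu>1 \<mu>3 \<and>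
        (\<forall>t\<in>{0..1}. F (distr M borel (\<lambda>(x1, x2, x3). (1 - t) *\<^sub>R x2 + t *\<^sub>R x3)) \<le>
           (1 - t) * F \<mu>2 + t * F \<mu>3
           - l / 2 * t * (1 - t) * (\<integral>(x1, x2, x3). (norm (x2 - x3))\<^sup>2 \<partial>M)))"

definition acceleration_free_convex :: "real \<Rightarrow> ('a::euclidean_space measure \<Rightarrow> real) \<Rightarrow> bool" where
  "acceleration_free_convex l F \<longleftrightarrow>
     (\<forall>\<mu>1\<in>P2. \<forall>\<mu>2\<in>P2. \<forall>\<gamma>\<in>plans \<mu>1 \<mu>2. \<forall>t\<in>{0..1}.
        F (distr \<gamma> borel (\<lambda>(x1, x2). (1 - t) *\<^sub>R x1 + t *\<^sub>R x2)) \<le>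
          (1 - t) * F \<mu>1 + t * F \<mu>2
          - l / 2 * t * (1 - t) * (\<integral>(x1, x2). (norm (x1 - x2))\<^sup>2 \<partial>\<gamma>))"

end

theory Submission
  imports Defs
begin

text \<open>The implications from acceleration-free curves to generalised geodesics and from there to geodesics
  are questions of existence of couplings; the implication from geodesics to acceleration-free curves
  is where differentiability enters.

  \<^bold>\<open>From geodesics to acceleration-free curves.\<close> Consider first finitely many particles moving
  with constant velocities, so that the position at time \<open>t\<close> is a random variable \<open>X + t V\<close> with \<open>X\<close> and
  \<open>V\<close> simple functions, and let \<open>f t\<close> be the value of the functional at its law. For \<open>s\<close> close to \<open>t\<close>
  each particle moves less than half the least distance between distinct positions at time \<open>t\<close>. Hence, among all
  positions occupied at time \<open>t\<close>, its own is the unique one nearest to its position at time \<open>s\<close>. So following the particles is the only optimal plan from time \<open>t\<close> to time \<open>s\<close>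
  (\<open>nearest_point_plan\<close>), whether or not particles collide at time \<open>t\<close>. Geodesic convexity therefore
  applies on the segment between \<open>t\<close> and \<open>s\<close>. Differentiability gives \<open>f\<close> one and the same slope at \<open>t\<close> for
  \<open>s < t\<close> and for \<open>s > t\<close>, because the derivative is linear in the displacement \<open>(s - t) V\<close>. Together these put
  a parabola of curvature \<open>l\<close> times the mean of \<open>|V|\<^sup>2\<close> below \<open>f\<close> near \<open>t\<close>, touching it at \<open>t\<close>
  (\<open>local_support\<close>). A continuous function with such a parabola at every point satisfies the
  corresponding convexity inequality (\<open>convex_if_locally_supported\<close>). Without differentiability the argument breaks
  down at collisions, where \<open>f\<close> could have a concave kink. A general plan is approximated in \<open>L\<^sup>2\<close> by
  simple functions, and a differentiable functional is continuous in the Wasserstein distance.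

  \<^bold>\<open>From acceleration-free curves to generalised geodesics.\<close> One needs a measure on triples whose
  marginals on the first and second and on the first and third factors are optimal plans
  (\<open>optimal_gluing\<close>). Two nearly optimal plans are glued approximately: the two copies of the common first
  coordinate are only required to lie in the same cell of a fine finite partition, and conditionally on
  the cell the two plans are made independent. The two copies coincide in
  the limit, so that one compactness argument (\<open>skorohod_subsequence\<close>) yields both the existence of optimal plans and
  their gluing.

  \<^bold>\<open>Compactness.\<close> A sequence of laws with bounded second moments has a subsequence that is
  represented by almost surely convergent random variables. On the real line this is Helly's selection theorem
  combined with Skorohod's representation. The general case is reduced to the line by coding a point as
  an element of the Cantor set whose ternary digits record which balls of a countable family contain the
  point.

  \<^bold>\<open>From generalised geodesics to geodesics.\<close> Take the base point equal to the starting point; an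
  optimal plan from a measure to itself is concentrated on the diagonal.\<close>

section \<open>Coding points by elements of the Cantor set\<close>

definition ternary_code :: "(nat \<Rightarrow> bool) \<Rightarrow> real" where
  "ternary_code b = (\<Sum>n. (if b n then 2 else 0) / 3 ^ Suc n)"

text \<open>Recursive digit extraction: \<open>ternary_rest y n\<close> is \<open>y\<close> shifted by \<open>n\<close> ternary places, and the next digit is
  read off by comparison with \<open>1/2\<close>, which lies in the middle third omitted by every code.\<close>

primrec ternary_rest :: "real \<Rightarrow> nat \<Rightarrow> real" where
  "ternary_rest y 0 = y"
| "ternary_rest y (Suc n) = 3 * ternary_rest y n - (if ternary_rest y n > 1/2 then 2 else 0)"

lemma ternary_code_summable: "summable (\<lambda>n. (if b n then 2 else 0) / 3 ^ Suc n :: real)"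
proof (rule summable_comparison_test')
  have "summable (\<lambda>n. (1/3)^n :: real)" by (intro summable_geometric) auto
  then show "summable (\<lambda>n. 2/3 * (1/3)^n :: real)" by (rule summable_mult)
qed (auto simp: power_divide)

lemma ternary_code_bounds: "0 \<le> ternary_code b" "ternary_code b \<le> 1"
proof -
  show "0 \<le> ternary_code b"
    unfolding ternary_code_def by (intro suminf_nonneg ternary_code_summable) auto
  have s: "(\<lambda>n. 2/3 * (1/3)^n :: real) sums (2/3 * (1 / (1 - 1/3)))"
    by (intro sums_mult geometric_sums) auto
  have "ternary_code b \<le> (\<Sum>n. 2/3 * (1/3)^n)"
    unfolding ternary_code_def
    by (intro suminf_le ternary_code_summable sums_summable[OF s]) (auto simp: power_divide)
  also have "\<dots> = 1" using sums_unique[OF s] by simp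
  finally show "ternary_code b \<le> 1" .
qed

lemma ternary_code_head:
  "ternary_code b = (if b 0 then 2/3 else 0) + ternary_code (\<lambda>n. b (Suc n)) / 3"
proof -
  have "ternary_code b - (if b 0 then 2/3 else 0) = (\<Sum>n. (if b (Suc n) then 2 else 0) / 3 ^ Suc (Suc n))"
    unfolding ternary_code_def using suminf_split_head[OF ternary_code_summable[of b]] by auto
  also have "\<dots> = (\<Sum>n. ((if b (Suc n) then 2 else 0) / 3 ^ Suc n) / 3)"
    by (intro arg_cong[where f=suminf] ext) auto
  also have "\<dots> = ternary_code (\<lambda>n. b (Suc n)) / 3"
    unfolding ternary_code_def by (rule suminf_divide[OF ternary_code_summable])
  finally show ?thesis by simp
qed

text \<open>The gap between \<open>1/3\<close> and \<open>2/3\<close> makes a single digit a continuous function of the code; everything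
  below rests on this.\<close>

lemma ternary_code_gap: "if b 0 then 2/3 \<le> ternary_code b else ternary_code b \<le> 1/3"
  using ternary_code_head[of b] ternary_code_bounds[of "\<lambda>n. b (Suc n)"] by auto

lemma ternary_rest_code: "ternary_rest (ternary_code b) n = ternary_code (\<lambda>k. b (n + k))"
proof (induction n)
  case (Suc n)
  then show ?case
    using ternary_code_head[of "\<lambda>k. b (n + k)"] ternary_code_gap[of "\<lambda>k. b (n + k)"]
    by (auto split: if_splits)
qed simp

lemma ternary_digit_code: "ternary_rest (ternary_code b) n > 1/2 \<longleftrightarrow> b n"
  using ternary_code_gap[of "\<lambda>k. b (n + k)"] by (auto simp: ternary_rest_code split: if_splits)

lemma ternary_rest_measurable [measurable]: "(\<lambda>y. ternary_rest y n) \<in> borel_measurable borel"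
  by (induction n) auto

text \<open>Convergent codes eventually stay on one side of the gap, which fixes the first digit; removing that
  digit is an affine map, so the shifted codes converge as well and induction applies.\<close>

lemma ternary_digits_eventually_constant:
  assumes "(\<lambda>k. ternary_code (b k)) \<longlonglongrightarrow> y"
  shows "\<exists>v. \<forall>\<^sub>F k in sequentially. b k n = v"
proof -
  have first: "\<exists>v. \<forall>\<^sub>F k in sequentially. c k 0 = v"
    if "(\<lambda>k. ternary_code (c k)) \<longlonglongrightarrow> z" for c and z :: real
  proof -
    have "\<forall>\<^sub>F k in sequentially. dist (ternary_code (c k)) z < 1/6"
      using that by (rule tendstoD) simp
    then have "\<forall>\<^sub>F k in sequentially. c k 0 = (z \<ge> 1/2)"
    proof eventually_elim
      case (elim k)
      then show ?case
        using ternary_code_gap[of "c k"] by (auto simp: dist_real_def abs_real_def split: if_splits)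
    qed
    then show ?thesis by blast
  qed
  have "\<exists>z. (\<lambda>k. ternary_code (\<lambda>j. b k (n + j))) \<longlonglongrightarrow> z"
  proof (induction n)
    case 0
    then show ?case using assms by auto
  next
    case (Suc n)
    then obtain z where z: "(\<lambda>k. ternary_code (\<lambda>j. b k (n + j))) \<longlonglongrightarrow> z" by blast
    from first[OF this] obtain v where v: "\<forall>\<^sub>F k in sequentially. b k n = v" by auto
    have "(\<lambda>k. 3 * ternary_code (\<lambda>j. b k (n + j)) - (if v then 2 else 0)) \<longlonglongrightarrow> 3 * z - (if v then 2 else 0)"
      by (intro tendsto_intros z)
    moreover have "\<forall>\<^sub>F k in sequentially. 3 * ternary_code (\<lambda>j. b k (n + j)) - (if v then 2 else 0)
        = ternary_code (\<lambda>j. b k (Suc n + j))"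
      using v
    proof eventually_elim
      case (elim k)
      then show ?case using ternary_code_head[of "\<lambda>j. b k (n + j)"] by auto
    qed
    ultimately show ?case by (intro exI) (rule Lim_transform_eventually)
  qed
  then show ?thesis using first by fastforce
qed

definition dense_seq :: "nat \<Rightarrow> 'a::second_countable_topology" where
  "dense_seq = from_nat_into (SOME D. countable D \<and> (\<forall>U. open U \<and> U \<noteq> {} \<longrightarrow> (\<exists>d\<in>D. d \<in> U)))"

lemma dense_seq_near:
  fixes x :: "'a::{metric_space, second_countable_topology}"
  assumes "\<epsilon> > 0"
  obtains i where "dist x (dense_seq i) < \<epsilon>"
proof -
  define D where "D = (SOME D :: 'a set. countable D \<and> (\<forall>U. open U \<and> U \<noteq> {} \<longrightarrow> (\<exists>d\<in>D. d \<in> U)))"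
  have "\<exists>D :: 'a set. countable D \<and> (\<forall>U. open U \<and> U \<noteq> {} \<longrightarrow> (\<exists>d\<in>D. d \<in> U))"
    by (rule countable_dense_setE) blast
  then have D: "countable D" "\<And>U. open U \<Longrightarrow> U \<noteq> {} \<Longrightarrow> \<exists>d\<in>D. d \<in> U"
    using someI_ex[of "\<lambda>D :: 'a set. countable D \<and> (\<forall>U. open U \<and> U \<noteq> {} \<longrightarrow> (\<exists>d\<in>D. d \<in> U))"]
    unfolding D_def by blast+
  obtain d where "d \<in> D" "d \<in> ball x \<epsilon>"
    using D(2)[of "ball x \<epsilon>"] assms by fastforce
  moreover obtain i where "from_nat_into D i = d"
    using from_nat_into_surj[OF D(1) \<open>d \<in> D\<close>] by blast
  ultimately have "dist x (dense_seq i) < \<epsilon>"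
    unfolding dense_seq_def D_def[symmetric] by auto
  then show ?thesis using that by blast
qed

definition point_bits :: "'a::{metric_space, second_countable_topology} \<Rightarrow> nat \<Rightarrow> bool" where
  "point_bits x n = (case prod_decode n of (i, m) \<Rightarrow> dist x (dense_seq i) < 1 / Suc m)"

definition point_code :: "'a::{metric_space, second_countable_topology} \<Rightarrow> real" where
  "point_code x = ternary_code (point_bits x)"

text \<open>The inverse is explicit, hence visibly Borel: for each radius take the first centre whose ball contains the
  point, and let the radius tend to zero.\<close>

definition point_decode :: "real \<Rightarrow> 'a::{banach, second_countable_topology}" where
  "point_decode y = lim (\<lambda>m. dense_seq (LEAST i. ternary_rest y (prod_encode (i, m)) > 1/2))"

lemma point_code_measurable [measurable]: "point_code \<in> borel_measurable borel"
  unfolding point_code_def ternary_code_def point_bits_def by measurable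

lemma point_decode_measurable [measurable]: 
  "(point_decode :: real \<Rightarrow> 'a::{banach, second_countable_topology}) \<in> borel_measurable borel"
  unfolding point_decode_def
proof (rule borel_measurable_lim_metric)
  fix m
  have *: "(\<lambda>y. LEAST i. ternary_rest y (prod_encode (i, m)) > 1/2) \<in> measurable borel (count_space UNIV)"
    by measurable
  show "(\<lambda>y. dense_seq (LEAST i. ternary_rest y (prod_encode (i, m)) > 1/2) :: 'a) \<in> borel_measurable borel"
    by (rule measurable_compose[OF *]) simp
qed

lemma point_decode_code: "point_decode (point_code x) = x"
proof -
  let ?i = "\<lambda>m. LEAST i. ternary_rest (point_code x) (prod_encode (i, m)) > 1/2"
  have near: "dist x (dense_seq (?i m)) < 1 / Suc m" for m
  proof -
    have eq: "ternary_rest (point_code x) (prod_encode (i, m)) > 1/2 \<longleftrightarrow> dist x (dense_seq i) < 1 / Suc m" for i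
      unfolding point_code_def ternary_digit_code by (simp add: point_bits_def)
    obtain i where "dist x (dense_seq i) < 1 / Suc m"
      by (rule dense_seq_near[of "1 / Suc m"]) auto
    then show ?thesis unfolding eq by (rule LeastI)
  qed
  have "(\<lambda>m. dense_seq (?i m)) \<longlonglongrightarrow> x"
    unfolding tendsto_dist_iff[of _ x]
    by (rule tendsto_sandwich[OF _ _ tendsto_const LIMSEQ_inverse_real_of_nat])
       (use near in \<open>auto intro!: always_eventually less_imp_le simp: dist_commute inverse_eq_divide\<close>)
  then show ?thesis unfolding point_decode_def by (rule limI)
qed

text \<open>Convergence of codes gives convergence of points only as long as the points do not escape to infinity: any
  cluster point lies in a small coded ball, and membership in that ball is eventually constant along
  the \<^emph>\<open>whole\<close> sequence.\<close>

lemma point_code_convergent: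
  fixes x :: "nat \<Rightarrow> 'a::{heine_borel, real_normed_vector, second_countable_topology}"
  assumes "(\<lambda>k. point_code (x k)) \<longlonglongrightarrow> y" and "\<not> filterlim (\<lambda>k. norm (x k)) at_top sequentially"
  shows "convergent x"
proof -
  obtain B where B: "\<exists>\<^sub>F k in sequentially. norm (x k) < B"
    using assms(2) unfolding filterlim_at_top frequently_def by (auto simp: not_less)
  then have "infinite {k. norm (x k) < B}"
    by (simp add: cofinite_eq_sequentially[symmetric] frequently_cofinite)
  from infinite_enumerate[OF this] obtain s :: "nat \<Rightarrow> nat"
    where s: "strict_mono s" "\<And>n. norm (x (s n)) < B" by auto
  have "bounded (range (x \<circ> s))"
    unfolding bounded_iff using s(2) by (auto intro!: exI[of _ B] less_imp_le)
  from bounded_imp_convergent_subsequence[OF this] obtain a u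
    where u: "strict_mono (u :: nat \<Rightarrow> nat)" "((x \<circ> s) \<circ> u) \<longlonglongrightarrow> a" by blast
  have su: "filterlim (s \<circ> u) sequentially sequentially"
    using s(1) u(1) by (intro filterlim_subseq strict_mono_o)
  have "x \<longlonglongrightarrow> a"
  proof (rule tendstoI)
    fix \<epsilon> :: real assume "\<epsilon> > 0"
    then obtain m where m: "1 / Suc m < \<epsilon> / 2" using nat_approx_posE[of "\<epsilon>/2"] by auto
    obtain i where i: "dist a (dense_seq i) < 1 / Suc m"
      by (rule dense_seq_near[of "1 / Suc m"]) auto
    obtain v where v: "\<forall>\<^sub>F k in sequentially. (dist (x k) (dense_seq i) < 1 / Suc m) = v"
      using ternary_digits_eventually_constant[OF assms(1)[unfolded point_code_def], of "prod_encode (i, m)"]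
      by (auto simp: point_bits_def)
    have "\<forall>\<^sub>F n in sequentially. dist (x ((s \<circ> u) n)) (dense_seq i) < 1 / Suc m"
      using order_tendstoD(2)[OF tendsto_dist[OF u(2) tendsto_const] i] by (simp add: o_def)
    moreover have "\<forall>\<^sub>F n in sequentially. (dist (x ((s \<circ> u) n)) (dense_seq i) < 1 / Suc m) = v"
      by (rule eventually_compose_filterlim[OF v su])
    ultimately have "\<forall>\<^sub>F n in sequentially. v" by eventually_elim auto
    then have "v" by simp
    from v show "\<forall>\<^sub>F k in sequentially. dist (x k) a < \<epsilon>"
    proof eventually_elim
      case (elim k)
      then have "dist (x k) (dense_seq i) < 1 / Suc m" using \<open>v\<close> by simp
      then show ?case using i m dist_triangle2[of "x k" a "dense_seq i"] by linarith
    qed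
  qed
  then show ?thesis by (rule convergentI)
qed

section \<open>Compactness of laws with bounded second moments\<close>

text \<open>Push the measures to \<open>[0, 1]\<close> by the code, where tightness is automatic, extract a weakly convergent
  subsequence, represent it by convergent random variables and decode these. The moment bound enters only
  through Fatou's lemma, to exclude escape to infinity.\<close>

theorem skorohod_subsequence:
  fixes \<gamma> :: "nat \<Rightarrow> 'a::euclidean_space measure"
  assumes P2: "\<And>n. \<gamma> n \<in> P2" and bound: "\<And>n. (\<integral>x. (norm x)\<^sup>2 \<partial>\<gamma> n) \<le> C"
  obtains \<Omega> :: "real measure" and X X' r where
    "prob_space \<Omega>" "strict_mono (r :: nat \<Rightarrow> nat)" 
    "\<And>n. X n \<in> borel_measurable \<Omega>" "X' \<in> borel_measurable \<Omega>"
    "\<And>n. distr \<Omega> borel (X n) = \<gamma> (r n)"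
    "AE \<omega> in \<Omega>. (\<lambda>n. X n \<omega>) \<longlonglongrightarrow> X' \<omega>"
proof -
  have prob: "prob_space (\<gamma> n)" and sets [measurable_cong]: "sets (\<gamma> n) = sets borel"
    and int: "integrable (\<gamma> n) (\<lambda>x. (norm x)\<^sup>2)" for n
    using P2[of n] by (auto simp: P2_def)
  define \<mu> where "\<mu> n = distr (\<gamma> n) borel point_code" for n
  have real_dist: "real_distribution (\<mu> n)" for n
    unfolding \<mu>_def by (rule prob_space.real_distribution_distr[OF prob]) measurable
  have "measure (\<mu> n) {-1<..1} = 1" for n
  proof -
    have "point_code -` {-1<..1} \<inter> space (\<gamma> n) = space (\<gamma> n)"
      using ternary_code_bounds by (auto simp: point_code_def less_le_trans[OF _ ternary_code_bounds(1)])
    then show ?thesis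
      unfolding \<mu>_def by (subst measure_distr) (auto simp: prob_space.prob_space[OF prob])
  qed
  then have "tight \<mu>"
    unfolding tight_def using real_dist by (intro conjI allI impI exI[of _ "-1::real"] exI[of _ "1::real"]) auto
  from tight_imp_convergent_subsubsequence[OF this strict_mono_id]
  obtain r M where r: "strict_mono (r :: nat \<Rightarrow> nat)" and M: "real_distribution M"
    and conv: "weak_conv_m (\<lambda>n. \<mu> (r n)) M" by (auto simp: o_def)
  from Skorohod[OF real_dist M conv] obtain \<Omega> :: "real measure" and Y Y' where
    \<Omega>: "prob_space \<Omega>" and Y [measurable]: "\<And>n. Y n \<in> borel_measurable \<Omega>"
    and law: "\<And>n. distr \<Omega> borel (Y n) = \<mu> (r n)"
    and Y': "\<And>\<omega>. \<omega> \<in> space \<Omega> \<Longrightarrow> (\<lambda>n. Y n \<omega>) \<longlonglongrightarrow> Y' \<omega>"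
    by blast
  interpret \<Omega>: prob_space \<Omega> by fact
  define X where "X n \<omega> = (point_decode (Y n \<omega>) :: 'a)" for n \<omega>
  define X' where "X' \<omega> = lim (\<lambda>n. X n \<omega>)" for \<omega>
  have X [measurable]: "X n \<in> borel_measurable \<Omega>" for n unfolding X_def by measurable
  have X' [measurable]: "X' \<in> borel_measurable \<Omega>" unfolding X'_def by measurable
  have X_law: "distr \<Omega> borel (X n) = \<gamma> (r n)" for n
  proof -
    have "distr \<Omega> borel (X n) = distr (distr \<Omega> borel (Y n)) borel point_decode"
      by (subst distr_distr) (auto simp: X_def[abs_def] o_def)
    also have "\<dots> = distr (\<gamma> (r n)) borel (\<lambda>x. x)"
      unfolding law \<mu>_def by (subst distr_distr) (auto simp: o_def point_decode_code)
    also have "\<dots> = \<gamma> (r n)"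
      by (intro distr_id2) (simp add: sets)
    finally show ?thesis .
  qed
  have code: "AE \<omega> in \<Omega>. point_code (X n \<omega>) = Y n \<omega>" for n
  proof -
    have "AE y in distr \<Omega> borel (Y n). point_code (point_decode y :: 'a) = y"
      unfolding law \<mu>_def by (subst AE_distr_iff) (auto simp: point_decode_code)
    then show ?thesis by (subst (asm) AE_distr_iff) (auto simp: X_def)
  qed
  have nn: "(\<integral>\<^sup>+\<omega>. ennreal ((norm (X n \<omega>))\<^sup>2) \<partial>\<Omega>) \<le> ennreal C" for n
  proof -
    have "(\<integral>\<^sup>+\<omega>. ennreal ((norm (X n \<omega>))\<^sup>2) \<partial>\<Omega>) = (\<integral>\<^sup>+x. ennreal ((norm x)\<^sup>2) \<partial>\<gamma> (r n))"
      unfolding X_law[symmetric] by (subst nn_integral_distr) auto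
    also have "\<dots> = ennreal (\<integral>x. (norm x)\<^sup>2 \<partial>\<gamma> (r n))"
      by (intro nn_integral_eq_integral int) auto
    also have "\<dots> \<le> ennreal C" by (intro ennreal_leI bound)
    finally show ?thesis .
  qed
  have "(\<integral>\<^sup>+\<omega>. liminf (\<lambda>n. ennreal ((norm (X n \<omega>))\<^sup>2)) \<partial>\<Omega>) \<le> liminf (\<lambda>n. \<integral>\<^sup>+\<omega>. ennreal ((norm (X n \<omega>))\<^sup>2) \<partial>\<Omega>)"
    by (rule nn_integral_liminf) measurable
  also have "\<dots> \<le> liminf (\<lambda>n::nat. ennreal C)"
    by (intro Liminf_mono always_eventually allI nn)
  also have "\<dots> < \<infinity>" by (simp add: Liminf_const)
  finally have "AE \<omega> in \<Omega>. liminf (\<lambda>n. ennreal ((norm (X n \<omega>))\<^sup>2)) \<noteq> \<infinity>"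
    by (intro nn_integral_noteq_infinite) auto
  moreover have "AE \<omega> in \<Omega>. \<forall>n. point_code (X n \<omega>) = Y n \<omega>"
    using code by (simp add: AE_all_countable)
  moreover have "AE \<omega> in \<Omega>. \<omega> \<in> space \<Omega>" by (rule AE_space)
  ultimately have "AE \<omega> in \<Omega>. (\<lambda>n. X n \<omega>) \<longlonglongrightarrow> X' \<omega>"
  proof eventually_elim
    case (elim \<omega>)
    have "\<not> filterlim (\<lambda>n. norm (X n \<omega>)) at_top sequentially"
    proof
      assume "filterlim (\<lambda>n. norm (X n \<omega>)) at_top sequentially"
      then have "filterlim (\<lambda>n. (norm (X n \<omega>))\<^sup>2) at_top sequentially"
        by (rule filterlim_pow_at_top[rotated]) simp
      then have "(\<lambda>n. ennreal ((norm (X n \<omega>))\<^sup>2)) \<longlonglongrightarrow> \<infinity>"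
        by (simp add: ennreal_tendsto_top_eq_at_top)
      then have "liminf (\<lambda>n. ennreal ((norm (X n \<omega>))\<^sup>2)) = \<infinity>"
        by (intro lim_imp_Liminf) auto
      with elim show False by simp
    qed
    moreover have "(\<lambda>n. point_code (X n \<omega>)) \<longlonglongrightarrow> Y' \<omega>"
      using Y' elim by simp
    ultimately have "convergent (\<lambda>n. X n \<omega>)"
      by (intro point_code_convergent) auto
    then show ?case unfolding X'_def by (rule convergent_LIMSEQ_iff[THEN iffD1])
  qed
  then show ?thesis using that \<Omega> r X X' X_law by blast
qed

text \<open>By Fatou's lemma for indicators the limit law is at most \<open>\<mu>\<close> on open sets, hence at least \<open>\<mu>\<close> on
  closed sets; since an open set is an increasing union of closed sets, both agree on open sets.\<close>

lemma law_of_limit: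
  fixes X :: "nat \<Rightarrow> 'b \<Rightarrow> 'a::metric_space"
  assumes \<Omega>: "prob_space \<Omega>" and [measurable]: "\<And>n. X n \<in> borel_measurable \<Omega>" "X' \<in> borel_measurable \<Omega>"
    and law: "\<And>n. distr \<Omega> borel (X n) = \<mu>"
    and conv: "AE \<omega> in \<Omega>. (\<lambda>n. X n \<omega>) \<longlonglongrightarrow> X' \<omega>"
  shows "distr \<Omega> borel X' = \<mu>"
proof -
  interpret \<Omega>: prob_space \<Omega> by fact
  interpret \<mu>: prob_space \<mu> unfolding law[of 0, symmetric] by (rule \<Omega>.prob_space_distr) measurable
  interpret \<nu>: prob_space "distr \<Omega> borel X'" by (rule \<Omega>.prob_space_distr) measurable
  have sets [measurable_cong, simp]: "sets \<mu> = sets borel" unfolding law[of 0, symmetric] by simp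
  have le: "emeasure (distr \<Omega> borel X') U \<le> emeasure \<mu> U" if "open U" for U
  proof -
    have [measurable]: "U \<in> sets borel" using that by (rule borel_open)
    have "emeasure (distr \<Omega> borel X') U = (\<integral>\<^sup>+\<omega>. indicator U (X' \<omega>) \<partial>\<Omega>)"
      using nn_integral_distr[of X' \<Omega> borel "indicator U"] by simp
    also have "\<dots> \<le> (\<integral>\<^sup>+\<omega>. liminf (\<lambda>n. indicator U (X n \<omega>)) \<partial>\<Omega>)"
    proof (rule nn_integral_mono_AE, use conv in eventually_elim)
      case (elim \<omega>)
      show ?case
      proof (cases "X' \<omega> \<in> U")
        case True
        then have "\<forall>\<^sub>F n in sequentially. X n \<omega> \<in> U"
          using elim that by (rule_tac topological_tendstoD)
        then have "\<forall>\<^sub>F n in sequentially. (1::ennreal) \<le> indicator U (X n \<omega>)"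
          by eventually_elim simp
        then show ?thesis using True by (auto intro: Liminf_bounded)
      qed simp
    qed
    also have "\<dots> \<le> liminf (\<lambda>n. \<integral>\<^sup>+\<omega>. indicator U (X n \<omega>) \<partial>\<Omega>)"
      by (rule nn_integral_liminf) measurable
    also have "(\<lambda>n. \<integral>\<^sup>+\<omega>. indicator U (X n \<omega>) \<partial>\<Omega>) = (\<lambda>n. emeasure \<mu> U)"
    proof
      fix n
      have "(\<integral>\<^sup>+\<omega>. indicator U (X n \<omega>) \<partial>\<Omega>) = emeasure (distr \<Omega> borel (X n)) U"
        using nn_integral_distr[of "X n" \<Omega> borel "indicator U"] by simp
      then show "(\<integral>\<^sup>+\<omega>. indicator U (X n \<omega>) \<partial>\<Omega>) = emeasure \<mu> U" by (simp add: law)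
    qed
    finally show ?thesis by (simp add: Liminf_const)
  qed
  have closed_ge: "measure \<mu> K \<le> measure (distr \<Omega> borel X') K" if "closed K" for K
  proof -
    have "measure (distr \<Omega> borel X') (- K) \<le> measure \<mu> (- K)"
      using le[of "- K"] that by (simp add: open_Compl \<mu>.emeasure_eq_measure \<nu>.emeasure_eq_measure)
    moreover have "- K = space (distr \<Omega> borel X') - K" "- K = space \<mu> - K"
      using sets_eq_imp_space_eq[OF sets] by auto
    ultimately show ?thesis
      using that \<mu>.prob_compl[of K] \<nu>.prob_compl[of K] by simp
  qed
  have open_eq: "emeasure (distr \<Omega> borel X') U = emeasure \<mu> U" if "open U" for U
  proof (rule antisym[OF le[OF that]])
    show "emeasure \<mu> U \<le> emeasure (distr \<Omega> borel X') U"
    proof (cases "U = UNIV")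
      case True
      then show ?thesis
        using closed_ge[of U] by (simp add: \<mu>.emeasure_eq_measure \<nu>.emeasure_eq_measure)
    next
      case False
      define K where "K n = {x. 1 / Suc n \<le> infdist x (- U)}" for n
      have K: "closed (K n)" for n
        unfolding K_def by (intro closed_Collect_le continuous_intros)
      have "incseq K"
        unfolding K_def by (intro monoI Collect_mono impI) (erule order_trans[rotated], simp add: frac_le)
      have U: "U = (\<Union>n. K n)"
      proof (intro set_eqI iffI)
        fix x assume "x \<in> U"
        then have "infdist x (- U) > 0"
          using infdist_pos_not_in_closed[of "- U" x] that False by auto
        from nat_approx_posE[OF this] obtain n where "1 / Suc n < infdist x (- U)" by auto
        then show "x \<in> (\<Union>n. K n)" unfolding K_def by (auto intro!: exI[of _ n])
      next
        fix x assume "x \<in> (\<Union>n. K n)"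
        then obtain n where "1 / Suc n \<le> infdist x (- U)" by (auto simp: K_def)
        then have "infdist x (- U) > 0" by (rule less_le_trans[rotated]) simp
        then show "x \<in> U" by (metis ComplI infdist_zero less_irrefl)
      qed
      have "emeasure \<mu> U = (SUP n. emeasure \<mu> (K n))"
        unfolding U by (intro SUP_emeasure_incseq[symmetric] \<open>incseq K\<close>) (auto intro: borel_closed K)
      also have "\<dots> \<le> (SUP n. emeasure (distr \<Omega> borel X') (K n))"
        using closed_ge[OF K] by (intro SUP_mono) (auto simp: \<mu>.emeasure_eq_measure \<nu>.emeasure_eq_measure)
      also have "\<dots> = emeasure (distr \<Omega> borel X') U"
        unfolding U by (intro SUP_emeasure_incseq \<open>incseq K\<close>) (auto intro: borel_closed K)
      finally show ?thesis .
    qed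
  qed
  show ?thesis
  proof (rule measure_eqI_generator_eq[where E="{U. open U}" and \<Omega>=UNIV and A="\<lambda>_. UNIV"])
    show "Int_stable {U :: 'a set. open U}" by (auto simp: Int_stable_def)
    show "emeasure (distr \<Omega> borel X') UNIV \<noteq> \<infinity>" by simp
    show "sets (distr \<Omega> borel X') = sigma_sets UNIV {U. open U}" "sets \<mu> = sigma_sets UNIV {U. open U}"
      by (simp_all add: sets_borel)
  qed (auto simp: open_eq)
qed

section \<open>Square-integrable random variables\<close>

lemma borel_measurable_fst_snd [measurable]:
  "(fst :: 'a::second_countable_topology \<times> 'b::second_countable_topology \<Rightarrow> 'a) \<in> borel_measurable borel"
  "(snd :: 'a \<times> 'b \<Rightarrow> 'b) \<in> borel_measurable borel"
  by (intro borel_measurable_continuous_onI continuous_intros)+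

text \<open>Plans and the measures \<open>\<mu>\<close> in \<open>P2\<close> are handled as laws of random variables on a common probability space;
  this is the integrability condition that corresponds to membership of the law in \<open>P2\<close>.\<close>

definition square_integrable :: "'b measure \<Rightarrow> ('b \<Rightarrow> 'a::euclidean_space) \<Rightarrow> bool" where
  "square_integrable M X \<longleftrightarrow> X \<in> borel_measurable M \<and> integrable M (\<lambda>x. (norm (X x))\<^sup>2)"

lemma square_integrableD [dest]:
  assumes "square_integrable M X"
  shows "X \<in> borel_measurable M" "integrable M (\<lambda>x. (norm (X x))\<^sup>2)"
  using assms by (auto simp: square_integrable_def)

lemma norm_add_square_le: "(norm (x + y))\<^sup>2 \<le> 2 * (norm x)\<^sup>2 + 2 * (norm y)\<^sup>2"
  for x y :: "'a::real_normed_vector"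
proof -
  have "(norm (x + y))\<^sup>2 \<le> (norm x + norm y)\<^sup>2"
    by (intro power_mono norm_triangle_ineq) simp
  also have "\<dots> \<le> 2 * (norm x)\<^sup>2 + 2 * (norm y)\<^sup>2"
    using sum_squares_bound[of "norm x" "norm y"] by (simp add: power2_sum)
  finally show ?thesis .
qed

lemma square_integrable_bound:
  assumes "U \<in> borel_measurable M" "integrable M g" "AE x in M. (norm (U x))\<^sup>2 \<le> g x"
  shows "square_integrable M U"
  unfolding square_integrable_def
proof (intro conjI Bochner_Integration.integrable_bound[OF assms(2)])
  show "AE x in M. norm ((norm (U x))\<^sup>2) \<le> norm (g x)"
    using assms(3) by eventually_elim auto
qed (use assms(1) in auto)

lemma square_integrable_add [intro]:
  assumes "square_integrable M X" "square_integrable M Y"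
  shows "square_integrable M (\<lambda>x. X x + Y x)"
  using assms
  by (intro square_integrable_bound[where g="\<lambda>x. 2 * (norm (X x))\<^sup>2 + 2 * (norm (Y x))\<^sup>2"])
     (auto simp: square_integrable_def norm_add_square_le)

lemma square_integrable_scaleR [intro]:
  assumes "square_integrable M X"
  shows "square_integrable M (\<lambda>x. c *\<^sub>R X x)"
  using assms by (auto simp: square_integrable_def power_mult_distrib)

lemma square_integrable_diff [intro]:
  assumes "square_integrable M X" "square_integrable M Y"
  shows "square_integrable M (\<lambda>x. X x - Y x)"
  using square_integrable_add[OF assms(1) square_integrable_scaleR[OF assms(2), of "-1"]] by simp

lemma square_integrable_Pair_iff:
  "square_integrable M (\<lambda>x. (X x, Y x)) \<longleftrightarrow> square_integrable M X \<and> square_integrable M Y"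
proof
  assume "square_integrable M X \<and> square_integrable M Y"
  then show "square_integrable M (\<lambda>x. (X x, Y x))"
    by (auto simp: square_integrable_def norm_Pair)
next
  assume XY: "square_integrable M (\<lambda>x. (X x, Y x))"
  have m: "X \<in> borel_measurable M" "Y \<in> borel_measurable M"
    using measurable_compose[OF square_integrableD(1)[OF XY] borel_measurable_fst_snd(1)]
      measurable_compose[OF square_integrableD(1)[OF XY] borel_measurable_fst_snd(2)] by simp_all
  show "square_integrable M X \<and> square_integrable M Y"
    by (intro conjI square_integrable_bound[OF _ square_integrableD(2)[OF XY]] m)
       (auto simp: norm_Pair)
qed

lemma square_integrable_fst [intro]:
  "square_integrable M X \<Longrightarrow> square_integrable M (\<lambda>x. fst (X x))"
  and square_integrable_snd [intro]:
  "square_integrable M X \<Longrightarrow> square_integrable M (\<lambda>x. snd (X x))"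
  using square_integrable_Pair_iff[of M "\<lambda>x. fst (X x)" "\<lambda>x. snd (X x)"] by simp_all

lemma square_integrable_fatou:
  assumes "\<And>n. square_integrable M (U n)" and [measurable]: "U' \<in> borel_measurable M"
    and conv: "AE x in M. (\<lambda>n. U n x) \<longlonglongrightarrow> U' x"
    and le: "\<And>n. (\<integral>x. (norm (U n x))\<^sup>2 \<partial>M) \<le> c n" and c: "c \<longlonglongrightarrow> c'"
  shows "square_integrable M U'" "(\<integral>x. (norm (U' x))\<^sup>2 \<partial>M) \<le> c'"
proof -
  have U [measurable]: "U n \<in> borel_measurable M" and int: "integrable M (\<lambda>x. (norm (U n x))\<^sup>2)" for n
    using assms(1)[of n] by auto
  have c0: "0 \<le> c n" for n by (rule order_trans[OF _ le]) (simp add: Bochner_Integration.integral_nonneg)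
  then have c'0: "0 \<le> c'" using c by (intro LIMSEQ_le_const) auto
  have "(\<integral>\<^sup>+x. ennreal ((norm (U' x))\<^sup>2) \<partial>M) \<le> (\<integral>\<^sup>+x. liminf (\<lambda>n. ennreal ((norm (U n x))\<^sup>2)) \<partial>M)"
  proof (rule nn_integral_mono_AE, use conv in eventually_elim)
    case (elim x)
    then have "(\<lambda>n. ennreal ((norm (U n x))\<^sup>2)) \<longlonglongrightarrow> ennreal ((norm (U' x))\<^sup>2)"
      by (intro tendsto_ennrealI tendsto_intros)
    then show ?case using lim_imp_Liminf[of sequentially] by fastforce
  qed
  also have "\<dots> \<le> liminf (\<lambda>n. \<integral>\<^sup>+x. ennreal ((norm (U n x))\<^sup>2) \<partial>M)"
    by (rule nn_integral_liminf) measurable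
  also have "\<dots> \<le> liminf (\<lambda>n. ennreal (c n))"
    by (intro Liminf_mono always_eventually allI)
       (simp add: nn_integral_eq_integral int ennreal_leI le)
  also have "\<dots> = ennreal c'"
    by (intro lim_imp_Liminf tendsto_ennrealI c) simp
  finally have *: "(\<integral>\<^sup>+x. ennreal ((norm (U' x))\<^sup>2) \<partial>M) \<le> ennreal c'" .
  then have int': "integrable M (\<lambda>x. (norm (U' x))\<^sup>2)"
    by (intro integrableI_bounded) (auto intro: le_less_trans)
  then show "square_integrable M U'" by (simp add: square_integrable_def)
  show "(\<integral>x. (norm (U' x))\<^sup>2 \<partial>M) \<le> c'"
    using * c'0 by (simp add: nn_integral_eq_integral[OF int'])
qed

lemma square_integrable_dominated:
  assumes U: "\<And>n. U n \<in> borel_measurable M" and U': "U' \<in> borel_measurable M"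
    and conv: "AE x in M. (\<lambda>n. U n x) \<longlonglongrightarrow> U' x"
    and le: "\<And>n. AE x in M. (norm (U n x))\<^sup>2 \<le> g x" and g: "integrable M g"
  shows "\<And>n. square_integrable M (U n)" "square_integrable M U'"
    "(\<lambda>n. \<integral>x. (norm (U n x))\<^sup>2 \<partial>M) \<longlonglongrightarrow> (\<integral>x. (norm (U' x))\<^sup>2 \<partial>M)"
proof -
  note [measurable] = U U' borel_measurable_integrable[OF g]
  have *: "AE x in M. (\<lambda>n. (norm (U n x))\<^sup>2) \<longlonglongrightarrow> (norm (U' x))\<^sup>2"
    using conv by eventually_elim (intro tendsto_intros)
  have **: "AE x in M. norm ((norm (U n x))\<^sup>2) \<le> g x" for n using le by simp
  show "square_integrable M (U n)" for n by (rule square_integrable_bound[OF U g le])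
  show "square_integrable M U'" 
    unfolding square_integrable_def
    by (intro conjI U' integrable_dominated_convergence[OF _ _ g * **]) measurable
  show "(\<lambda>n. \<integral>x. (norm (U n x))\<^sup>2 \<partial>M) \<longlonglongrightarrow> (\<integral>x. (norm (U' x))\<^sup>2 \<partial>M)"
    by (intro integral_dominated_convergence[OF _ _ g * **]) measurable
qed

lemma simple_function_square_integrable:
  fixes X :: "'b \<Rightarrow> 'a::euclidean_space"
  assumes "prob_space M" "simple_function M X"
  shows "square_integrable M X"
proof -
  interpret prob_space M by fact
  obtain B where "\<And>x. x \<in> space M \<Longrightarrow> norm (X x) \<le> B"
    using finite_imp_bounded[OF simple_functionD(1)[OF assms(2)]] unfolding bounded_iff by auto
  then show ?thesis
    using borel_measurable_simple_function[OF assms(2)]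
    by (intro square_integrable_bound[where g="\<lambda>_. B\<^sup>2"]) (auto intro!: AE_I2 power_mono)
qed

lemma square_integrable_distr:
  assumes [measurable]: "X \<in> measurable M N" "f \<in> borel_measurable N"
  shows "square_integrable (distr M N X) f \<longleftrightarrow> square_integrable M (\<lambda>x. f (X x))"
  by (simp add: square_integrable_def integrable_distr_eq)

section \<open>Plans and the Wasserstein distance\<close>

lemma P2_iff: "\<mu> \<in> P2 \<longleftrightarrow> prob_space \<mu> \<and> sets \<mu> = sets borel \<and> square_integrable \<mu> (\<lambda>x. x)"
  by (auto simp: P2_def square_integrable_def cong: measurable_cong_sets)

lemma law_in_P2:
  assumes "prob_space M" "square_integrable M X"
  shows "distr M borel X \<in> P2"
  using assms by (auto simp: P2_iff square_integrable_distr square_integrableD intro!: prob_space.prob_space_distr)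

lemma square_integrable_of_law:
  assumes "X \<in> borel_measurable M" "distr M borel X \<in> P2"
  shows "square_integrable M X"
  using assms(2) square_integrable_distr[OF assms(1), of "\<lambda>x. x"] unfolding P2_iff by simp

lemma law_in_plans:
  assumes M: "prob_space M" and X: "square_integrable M X" and Y: "square_integrable M Y"
  shows "distr M borel (\<lambda>\<omega>. (X \<omega>, Y \<omega>)) \<in> plans (distr M borel X) (distr M borel Y)"
proof -
  have [measurable]: "X \<in> borel_measurable M" "Y \<in> borel_measurable M" using X Y by auto
  have "distr M borel (\<lambda>\<omega>. (X \<omega>, Y \<omega>)) \<in> P2"
    using X Y by (intro law_in_P2 M) (simp add: square_integrable_Pair_iff)
  then show ?thesis
    unfolding plans_def by (auto simp: distr_distr o_def)
qed

lemma cost_law: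
  assumes "X \<in> borel_measurable M" "Y \<in> borel_measurable M"
  shows "(\<integral>(x1, x2). (norm (x1 - x2))\<^sup>2 \<partial>distr M borel (\<lambda>\<omega>. (X \<omega>, Y \<omega>))) 
    = (\<integral>\<omega>. (norm (X \<omega> - Y \<omega> :: 'a::euclidean_space))\<^sup>2 \<partial>M)"
proof -
  note [measurable] = assms
  show ?thesis unfolding case_prod_beta by (subst integral_distr) auto
qed

lemma plansD:
  assumes "\<gamma> \<in> plans \<mu> \<nu>"
  shows "prob_space \<gamma>" "sets \<gamma> = sets borel" "square_integrable \<gamma> fst" "square_integrable \<gamma> snd"
    "distr \<gamma> borel fst = \<mu>" "distr \<gamma> borel snd = \<nu>" "\<mu> \<in> P2" "\<nu> \<in> P2"
proof -
  have \<gamma>: "prob_space \<gamma>" "sets \<gamma> = sets borel" "square_integrable \<gamma> (\<lambda>x. x)" 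
    and law: "distr \<gamma> borel fst = \<mu>" "distr \<gamma> borel snd = \<nu>"
    using assms by (auto simp: plans_def P2_iff)
  have s: "square_integrable \<gamma> fst" "square_integrable \<gamma> snd"
    using square_integrable_fst[OF \<gamma>(3)] square_integrable_snd[OF \<gamma>(3)] by simp_all
  show "prob_space \<gamma>" "sets \<gamma> = sets borel" "square_integrable \<gamma> fst" "square_integrable \<gamma> snd"
    "distr \<gamma> borel fst = \<mu>" "distr \<gamma> borel snd = \<nu>" by fact+
  show "\<mu> \<in> P2" "\<nu> \<in> P2"
    using law_in_P2[OF \<gamma>(1) s(1)] law_in_P2[OF \<gamma>(1) s(2)] by (simp_all add: law)
qed

lemma plan_as_law: "\<gamma> \<in> plans \<mu> \<nu> \<Longrightarrow> distr \<gamma> borel (\<lambda>z. (fst z, snd z)) = \<gamma>"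
  using plansD(2)[of \<gamma>] by (auto intro!: distr_id2)

text \<open>The measure \<open>\<Theta>\<close> has the density \<open>1 / p c\<close> on the product of the two cells with label \<open>c\<close>, and
  zero off these products, relative to the product measure; here \<open>p c\<close> is the common mass of both cells.
  Conditionally on the label the two components are independent, which preserves the marginals. Constant \<open>f\<close> and \<open>g\<close> give the
  product measure.\<close>

lemma glue_over_finite_partition:
  fixes \<mu> :: "'a::euclidean_space measure" and \<nu> :: "'b::euclidean_space measure"
  assumes "\<mu> \<in> P2" "\<nu> \<in> P2"
    and f: "f \<in> measurable borel (count_space UNIV)" and g: "g \<in> measurable borel (count_space UNIV)"
    and fin: "finite (range f)"
    and law: "\<And>c. emeasure \<mu> (f -` {c}) = emeasure \<nu> (g -` {c})"
  obtains \<Theta> where "\<Theta> \<in> P2" "distr \<Theta> borel fst = \<mu>" "distr \<Theta> borel snd = \<nu>"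
    "AE z in \<Theta>. f (fst z) = g (snd z)"
proof -
  have \<mu>: "prob_space \<mu>" "sets \<mu> = sets borel" "square_integrable \<mu> (\<lambda>x. x)" 
    and \<nu>: "prob_space \<nu>" "sets \<nu> = sets borel" "square_integrable \<nu> (\<lambda>x. x)" 
    using assms by (auto simp: P2_iff)
  interpret \<mu>: prob_space \<mu> by fact
  interpret \<nu>: prob_space \<nu> by fact
  interpret pair_prob_space \<mu> \<nu> ..
  note [measurable_cong] = \<mu>(2) \<nu>(2)
  have cells [measurable]: "f -` {c} \<in> sets borel" "g -` {c} \<in> sets borel" for c
    using measurable_sets[OF f, of "{c}"] measurable_sets[OF g, of "{c}"] by simp_all
  have prod: "sets (\<mu> \<Otimes>\<^sub>M \<nu>) = sets borel"
    using sets_pair_measure_cong[OF \<mu>(2) \<nu>(2)] unfolding borel_prod .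
  define p where "p c = emeasure \<mu> (f -` {c})" for c
  have p': "p c = emeasure \<nu> (g -` {c})" for c by (simp add: p_def law)
  have p_fin: "p c \<noteq> \<infinity>" for c by (simp add: p_def)
  define h where "h x y = (\<Sum>c\<in>range f. indicator (f -` {c}) x * indicator (g -` {c}) y / p c)" for x y
  have h [measurable]: "(\<lambda>z. h (fst z) (snd z)) \<in> borel_measurable (\<mu> \<Otimes>\<^sub>M \<nu>)"
    unfolding h_def by measurable
  have collapse: "(\<Sum>c\<in>range f. indicator (f -` {c}) x * r c) = r (f x)" for x and r :: "_ \<Rightarrow> ennreal"
    using fin by (subst sum.remove[of _ "f x"]) (auto simp: indicator_def intro!: sum.neutral)
  \<comment> \<open>Cells of mass zero, where the density is not normalised, are negligible since there are finitely many.\<close>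
  have int_y: "AE x in \<mu>. (\<integral>\<^sup>+y. h x y \<partial>\<nu>) = 1"
  proof -
    have "AE x in \<mu>. \<forall>c\<in>range f. p c = 0 \<longrightarrow> x \<notin> f -` {c}"
      using fin by (intro AE_finite_allI) (auto intro!: AE_I'[of "f -` {_}"] simp: p_def null_sets_def cells \<mu>(2))
    then show ?thesis
    proof eventually_elim
      case (elim x)
      have "(\<integral>\<^sup>+y. h x y \<partial>\<nu>) = (\<Sum>c\<in>range f. indicator (f -` {c}) x * (p c / p c))"
        unfolding h_def p' by (subst nn_integral_sum) (simp_all add: ennreal_times_divide[symmetric] nn_integral_cmult nn_integral_divide)
      also have "\<dots> = p (f x) / p (f x)" by (rule collapse)
      also have "\<dots> = 1" using elim p_fin by (intro ennreal_divide_self) (auto simp: top.not_eq_extremum)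
      finally show ?case .
    qed
  qed
  have int_x: "AE y in \<nu>. (\<integral>\<^sup>+x. h x y \<partial>\<mu>) = 1"
  proof -
    have "emeasure \<nu> (g -` range f) = (\<Sum>c\<in>range f. emeasure \<nu> (g -` {c}))"
      using fin by (subst sum_emeasure) (auto simp: \<nu>(2) disjoint_family_on_def intro!: arg_cong[where f="emeasure \<nu>"])
    also have "\<dots> = (\<Sum>c\<in>range f. emeasure \<mu> (f -` {c}))" by (simp add: law)
    also have "\<dots> = emeasure \<mu> UNIV"
      using fin by (subst sum_emeasure) (auto simp: \<mu>(2) disjoint_family_on_def intro!: arg_cong[where f="emeasure \<mu>"])
    also have "\<dots> = 1" using \<mu>.emeasure_space_1 sets_eq_imp_space_eq[OF \<mu>(2)] by simp
    finally have range: "AE y in \<nu>. y \<in> g -` range f"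
      by (intro \<nu>.AE_prob_1) (simp add: \<nu>.emeasure_eq_measure)
    have "AE y in \<nu>. \<forall>c\<in>range f. p c = 0 \<longrightarrow> y \<notin> g -` {c}"
      using fin by (intro AE_finite_allI) (auto intro!: AE_I'[of "g -` {_}"] simp: p' null_sets_def cells \<nu>(2))
    with range show ?thesis
    proof eventually_elim
      case (elim y)
      have "(\<integral>\<^sup>+x. h x y \<partial>\<mu>) = (\<Sum>c\<in>range f. indicator (g -` {c}) y * (p c / p c))"
        unfolding h_def p_def 
        by (subst nn_integral_sum)
           (simp_all add: ennreal_times_divide[symmetric] nn_integral_cmult nn_integral_divide mult.commute[of "indicator (f -` _) _"])
      also have "\<dots> = p (g y) / p (g y)"
        using fin elim by (subst sum.remove[of _ "g y"]) (auto simp: indicator_def intro!: sum.neutral)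
      also have "\<dots> = 1" using elim p_fin by (intro ennreal_divide_self) (auto simp: top.not_eq_extremum)
      finally show ?case .
    qed
  qed
  define \<Theta> where "\<Theta> = density (\<mu> \<Otimes>\<^sub>M \<nu>) (\<lambda>z. h (fst z) (snd z))"
  have \<Theta>_sets [measurable_cong]: "sets \<Theta> = sets borel" unfolding \<Theta>_def by (simp add: prod)
  have fst_law: "distr \<Theta> borel fst = \<mu>"
  proof (rule measure_eqI)
    fix A assume "A \<in> sets (distr \<Theta> borel fst)"
    then have A [measurable]: "A \<in> sets borel" by simp
    have "emeasure (distr \<Theta> borel fst) A = (\<integral>\<^sup>+z. indicator A (fst z) \<partial>\<Theta>)"
      using nn_integral_distr[of fst \<Theta> borel "indicator A"] by simp
    also have "\<dots> = (\<integral>\<^sup>+z. h (fst z) (snd z) * indicator A (fst z) \<partial>(\<mu> \<Otimes>\<^sub>M \<nu>))"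
      unfolding \<Theta>_def by (subst nn_integral_density) auto
    also have "\<dots> = (\<integral>\<^sup>+x. \<integral>\<^sup>+y. h x y * indicator A x \<partial>\<nu> \<partial>\<mu>)"
      by (subst \<nu>.nn_integral_fst[symmetric]) auto
    also have "\<dots> = (\<integral>\<^sup>+x. (\<integral>\<^sup>+y. h x y \<partial>\<nu>) * indicator A x \<partial>\<mu>)"
      by (intro nn_integral_cong nn_integral_multc) (auto simp: h_def)
    also have "\<dots> = (\<integral>\<^sup>+x. indicator A x \<partial>\<mu>)"
      using int_y by (intro nn_integral_cong_AE) auto
    finally show "emeasure (distr \<Theta> borel fst) A = emeasure \<mu> A" by (simp add: \<mu>(2))
  qed (simp add: \<mu>(2))
  have snd_law: "distr \<Theta> borel snd = \<nu>"
  proof (rule measure_eqI)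
    fix A assume "A \<in> sets (distr \<Theta> borel snd)"
    then have A [measurable]: "A \<in> sets borel" by simp
    have "emeasure (distr \<Theta> borel snd) A = (\<integral>\<^sup>+z. indicator A (snd z) \<partial>\<Theta>)"
      using nn_integral_distr[of snd \<Theta> borel "indicator A"] by simp
    also have "\<dots> = (\<integral>\<^sup>+z. h (fst z) (snd z) * indicator A (snd z) \<partial>(\<mu> \<Otimes>\<^sub>M \<nu>))"
      unfolding \<Theta>_def by (subst nn_integral_density) auto
    also have "\<dots> = (\<integral>\<^sup>+y. \<integral>\<^sup>+x. h x y * indicator A y \<partial>\<mu> \<partial>\<nu>)"
      by (subst nn_integral_snd[symmetric]) (auto simp: split_beta')
    also have "\<dots> = (\<integral>\<^sup>+y. (\<integral>\<^sup>+x. h x y \<partial>\<mu>) * indicator A y \<partial>\<nu>)"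
      by (intro nn_integral_cong nn_integral_multc) (auto simp: h_def)
    also have "\<dots> = (\<integral>\<^sup>+y. indicator A y \<partial>\<nu>)"
      using int_x by (intro nn_integral_cong_AE) auto
    finally show "emeasure (distr \<Theta> borel snd) A = emeasure \<nu> A" by (simp add: \<nu>(2))
  qed (simp add: \<nu>(2))
  have m: "fst \<in> borel_measurable \<Theta>" "snd \<in> borel_measurable \<Theta>" by measurable
  have "prob_space (distr \<Theta> borel fst)" unfolding fst_law by fact
  then have "prob_space \<Theta>" using m(1) by (rule prob_space_distrD[rotated])
  moreover have "square_integrable \<Theta> fst" "square_integrable \<Theta> snd"
    using \<mu>(3) \<nu>(3) square_integrable_distr[OF m(1), of "\<lambda>x. x"] square_integrable_distr[OF m(2), of "\<lambda>x. x"]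
    by (simp_all add: fst_law snd_law)
  then have "square_integrable \<Theta> (\<lambda>z. z)"
    using square_integrable_Pair_iff[of \<Theta> fst snd] by simp
  ultimately have "\<Theta> \<in> P2" using \<Theta>_sets by (simp add: P2_iff)
  moreover have "AE z in \<Theta>. f (fst z) = g (snd z)"
  proof -
    have "h x y = 0" if "f x \<noteq> g y" for x y
      unfolding h_def using that by (intro sum.neutral) (auto simp: indicator_def)
    then show ?thesis
      unfolding \<Theta>_def by (subst AE_density) (use h in \<open>fastforce intro!: AE_I2\<close>)+
  qed
  ultimately show ?thesis using that fst_law snd_law by blast
qed

lemma plans_nonempty:
  assumes "\<mu> \<in> P2" "\<nu> \<in> P2"
  shows "plans \<mu> \<nu> \<noteq> {}"
proof -
  have "emeasure \<mu> UNIV = 1" "emeasure \<nu> UNIV = 1"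
    using assms prob_space.emeasure_space_1 sets_eq_imp_space_eq unfolding P2_def
    by (metis (mono_tags, lifting) mem_Collect_eq space_borel)+
  then obtain \<Theta> where "\<Theta> \<in> P2" "distr \<Theta> borel fst = \<mu>" "distr \<Theta> borel snd = \<nu>"
    by (rule_tac glue_over_finite_partition[OF assms, of "\<lambda>_. ()" "\<lambda>_. ()"]) (auto simp: vimage_def)
  then show ?thesis by (auto simp: plans_def)
qed

lemma W2_nonneg: 
  assumes "plans \<mu> \<nu> \<noteq> {}"
  shows "0 \<le> W2 \<mu> \<nu>"
  unfolding W2_def using assms by (intro cINF_greatest) (auto intro!: Bochner_Integration.integral_nonneg)

lemma W2_square_le:
  assumes "\<gamma> \<in> plans \<mu> \<nu>"
  shows "(W2 \<mu> \<nu>)\<^sup>2 \<le> (\<integral>(x1, x2). (norm (x1 - x2))\<^sup>2 \<partial>\<gamma>)"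
proof -
  have nn: "0 \<le> (\<integral>(x1, x2). (norm (x1 - x2 :: 'a))\<^sup>2 \<partial>\<gamma>')" for \<gamma>' :: "('a \<times> 'a) measure"
    by (rule Bochner_Integration.integral_nonneg) auto
  have "W2 \<mu> \<nu> \<le> sqrt (\<integral>(x1, x2). (norm (x1 - x2))\<^sup>2 \<partial>\<gamma>)"
    unfolding W2_def using assms nn by (intro cINF_lower bdd_belowI2[of _ 0]) auto
  then have "(W2 \<mu> \<nu>)\<^sup>2 \<le> (sqrt (\<integral>(x1, x2). (norm (x1 - x2))\<^sup>2 \<partial>\<gamma>))\<^sup>2"
    using W2_nonneg[of \<mu> \<nu>] assms by (intro power_mono) auto
  then show ?thesis using nn[of \<gamma>] by simp
qed

text \<open>Replaces optimal plans before their existence is known.\<close>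

lemma nearly_optimal_plan:
  assumes "\<mu> \<in> P2" "\<nu> \<in> P2" "\<epsilon> > 0"
  obtains \<gamma> where "\<gamma> \<in> plans \<mu> \<nu>" "(\<integral>(x1, x2). (norm (x1 - x2))\<^sup>2 \<partial>\<gamma>) \<le> (W2 \<mu> \<nu>)\<^sup>2 + \<epsilon>"
proof -
  have nn: "0 \<le> (\<integral>(x1, x2). (norm (x1 - x2 :: 'a))\<^sup>2 \<partial>\<gamma>')" for \<gamma>' :: "('a \<times> 'a) measure"
    by (rule Bochner_Integration.integral_nonneg) auto
  have "W2 \<mu> \<nu> < sqrt ((W2 \<mu> \<nu>)\<^sup>2 + \<epsilon>)"
    using assms(3) by (intro real_less_rsqrt) simp
  then obtain \<gamma> where \<gamma>: "\<gamma> \<in> plans \<mu> \<nu>" 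
    "sqrt (\<integral>(x1, x2). (norm (x1 - x2))\<^sup>2 \<partial>\<gamma>) < sqrt ((W2 \<mu> \<nu>)\<^sup>2 + \<epsilon>)"
    unfolding W2_def using plans_nonempty[OF assms(1,2)] nn
    by (subst (asm) cINF_less_iff) (auto intro!: bdd_belowI2[of _ 0])
  then show ?thesis using that by auto
qed

lemma W2_square_ge:
  assumes "\<mu> \<in> P2" "\<nu> \<in> P2" "\<And>\<gamma>. \<gamma> \<in> plans \<mu> \<nu> \<Longrightarrow> c \<le> (\<integral>(x1, x2). (norm (x1 - x2))\<^sup>2 \<partial>\<gamma>)"
  shows "c \<le> (W2 \<mu> \<nu>)\<^sup>2"
proof (rule field_le_epsilon)
  fix e :: real assume "e > 0"
  then obtain \<gamma> where "\<gamma> \<in> plans \<mu> \<nu>" "(\<integral>(x1, x2). (norm (x1 - x2))\<^sup>2 \<partial>\<gamma>) \<le> (W2 \<mu> \<nu>)\<^sup>2 + e"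
    using nearly_optimal_plan[OF assms(1,2)] by blast
  then show "c \<le> (W2 \<mu> \<nu>)\<^sup>2 + e" using assms(3) by fastforce
qed

lemma W2_self: 
  assumes "\<mu> \<in> P2"
  shows "W2 \<mu> \<mu> = 0"
proof -
  have \<mu>: "prob_space \<mu>" "sets \<mu> = sets borel" "square_integrable \<mu> (\<lambda>x. x)" using assms by (auto simp: P2_iff)
  have "(W2 \<mu> \<mu>)\<^sup>2 \<le> 0"
    using W2_square_le[OF law_in_plans[OF \<mu>(1) \<mu>(3) \<mu>(3)]] cost_law[of "\<lambda>x. x" \<mu> "\<lambda>x. x"] \<mu>
    by (simp add: distr_id2 square_integrableD)
  then show ?thesis by simp
qed

lemma opt_plansI:
  assumes "\<gamma> \<in> plans \<mu> \<nu>" "(\<integral>(x1, x2). (norm (x1 - x2))\<^sup>2 \<partial>\<gamma>) \<le> (W2 \<mu> \<nu>)\<^sup>2"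
  shows "\<gamma> \<in> opt_plans \<mu> \<nu>"
  using assms W2_square_le[OF assms(1)] by (auto simp: opt_plans_def)

section \<open>Existence and gluing of optimal plans\<close>

text \<open>For each \<open>n\<close> glue two plans that are optimal up to \<open>1 / Suc n\<close> along the level sets of a simple function
  \<open>q n\<close> approximating the identity. The glued measures live on quadruples \<open>((a, b), (a', c))\<close> with \<open>a\<close>
  and \<open>a'\<close> in the same level set, so \<open>a - a'\<close> tends to zero in \<open>L\<^sup>2\<close>. In the limit \<open>a = a'\<close>, the
  marginals are unchanged, and Fatou's lemma turns near optimality into optimality.\<close>

lemma optimal_gluing:
  fixes \<mu>1 \<mu>2 \<mu>3 :: "'a::euclidean_space measure"
  assumes "\<mu>1 \<in> P2" "\<mu>2 \<in> P2" "\<mu>3 \<in> P2"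
  obtains M :: "('a \<times> 'a \<times> 'a) measure" where "M \<in> P2"
    "distr M borel (\<lambda>(x1, x2, x3). (x1, x2)) \<in> opt_plans \<mu>1 \<mu>2"
    "distr M borel (\<lambda>(x1, x2, x3). (x1, x3)) \<in> opt_plans \<mu>1 \<mu>3"
proof -
  have \<mu>1: "prob_space \<mu>1" "sets \<mu>1 = sets borel" "square_integrable \<mu>1 (\<lambda>x. x)"
    using assms(1) by (auto simp: P2_iff)
  have "\<exists>\<gamma>\<in>plans \<mu>1 \<mu>2. (\<integral>(x1, x2). (norm (x1 - x2))\<^sup>2 \<partial>\<gamma>) \<le> (W2 \<mu>1 \<mu>2)\<^sup>2 + inverse (real (Suc n))" for n
    by (rule nearly_optimal_plan[OF assms(1,2), of "inverse (real (Suc n))"]) auto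
  then obtain \<gamma> where \<gamma>: "\<And>n. \<gamma> n \<in> plans \<mu>1 \<mu>2" 
    "\<And>n. (\<integral>(x1, x2). (norm (x1 - x2))\<^sup>2 \<partial>\<gamma> n) \<le> (W2 \<mu>1 \<mu>2)\<^sup>2 + inverse (real (Suc n))"
    by metis
  have "\<exists>\<gamma>\<in>plans \<mu>1 \<mu>3. (\<integral>(x1, x2). (norm (x1 - x2))\<^sup>2 \<partial>\<gamma>) \<le> (W2 \<mu>1 \<mu>3)\<^sup>2 + inverse (real (Suc n))" for n
    by (rule nearly_optimal_plan[OF assms(1,3), of "inverse (real (Suc n))"]) auto
  then obtain \<gamma>' where \<gamma>': "\<And>n. \<gamma>' n \<in> plans \<mu>1 \<mu>3" 
    "\<And>n. (\<integral>(x1, x2). (norm (x1 - x2))\<^sup>2 \<partial>\<gamma>' n) \<le> (W2 \<mu>1 \<mu>3)\<^sup>2 + inverse (real (Suc n))"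
    by metis
  \<comment> \<open>The library supplies simple functions with twice the norm as a bound, hence the constant 3 in the error bound below.\<close>
  obtain q :: "nat \<Rightarrow> 'a \<Rightarrow> 'a" where q: "\<And>n. simple_function borel (q n)" "\<And>x. (\<lambda>n. q n x) \<longlonglongrightarrow> x"
    "\<And>n x. norm (q n x) \<le> 2 * norm x"
    using borel_measurable_implies_sequence_metric[of "\<lambda>x::'a. x" borel 0] by (auto simp: dist_norm)
  have q_meas [measurable]: "q n \<in> borel_measurable borel" for n
    using q(1) by (rule borel_measurable_simple_function)
  have q_count [measurable]: "q n \<in> measurable borel (count_space UNIV)" for n
    using q(1) by (rule measurable_simple_function)
  define e where "e n = (\<integral>x. (norm (q n x - x))\<^sup>2 \<partial>\<mu>1)" for n
  note q_conv = square_integrable_dominated[of "\<lambda>n x. q n x - x" \<mu>1 "\<lambda>x. 0" "\<lambda>x. 9 * (norm x)\<^sup>2"]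
  have q_err: "square_integrable \<mu>1 (\<lambda>x. q n x - x)" "e \<longlonglongrightarrow> 0" for n
  proof -
    have m: "(\<lambda>x. q n x - x) \<in> borel_measurable \<mu>1" for n
      using \<mu>1(2) by (simp cong: measurable_cong_sets)
    have c: "(\<lambda>n. q n x - x) \<longlonglongrightarrow> 0" for x
      using tendsto_diff[OF q(2)[of x] tendsto_const[of x]] by simp
    have b: "(norm (q n x - x))\<^sup>2 \<le> 9 * (norm x)\<^sup>2" for n x
    proof -
      have "norm (q n x - x) \<le> 3 * norm x" using norm_triangle_ineq4[of "q n x" x] q(3)[of n x] by simp
      then have "(norm (q n x - x))\<^sup>2 \<le> (3 * norm x)\<^sup>2" by (intro power_mono) auto
      then show ?thesis by (simp add: power_mult_distrib)
    qed
    have i: "integrable \<mu>1 (\<lambda>x. 9 * (norm x)\<^sup>2)" using \<mu>1(3) by auto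
    show "square_integrable \<mu>1 (\<lambda>x. q n x - x)" "e \<longlonglongrightarrow> 0"
      using q_conv[OF m _ _ _ i] b c unfolding e_def by simp_all
  qed
  have "\<exists>\<Theta>. \<Theta> \<in> P2 \<and> distr \<Theta> borel fst = \<gamma> n \<and> distr \<Theta> borel snd = \<gamma>' n \<and>
      (AE z in \<Theta>. q n (fst (fst z)) = q n (fst (snd z)))" for n
  proof -
    have P: "\<gamma> n \<in> P2" "\<gamma>' n \<in> P2" using \<gamma>(1)[of n] \<gamma>'(1)[of n] by (simp_all add: plans_def)
    have m: "(\<lambda>z::'a \<times> 'a. q n (fst z)) \<in> measurable borel (count_space UNIV)"
      by (rule measurable_compose[OF borel_measurable_fst_snd(1) q_count])
    have fin: "finite (range (\<lambda>z::'a \<times> 'a. q n (fst z)))"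
      using simple_functionD(1)[OF q(1)[of n]] by (rule finite_subset[rotated]) auto
    have [measurable]: "q n -` {c} \<in> sets borel" for c
      using measurable_sets[OF q_count, of "{c}"] by simp
    have *: "emeasure \<rho> ((\<lambda>z. q n (fst z)) -` {c}) = emeasure \<mu>1 (q n -` {c})" 
      if \<rho>: "\<rho> \<in> plans \<mu>1 \<nu>" for \<rho> c and \<nu> :: "'a measure"
    proof -
      have "space \<rho> = UNIV" using sets_eq_imp_space_eq[OF plansD(2)[OF \<rho>]] by simp
      moreover have "emeasure (distr \<rho> borel fst) (q n -` {c}) = emeasure \<rho> (fst -` (q n -` {c}) \<inter> space \<rho>)"
        using plansD(3)[OF \<rho>] by (intro emeasure_distr) auto
      ultimately show ?thesis by (simp add: plansD(5)[OF \<rho>] vimage_def)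
    qed
    have law: "emeasure (\<gamma> n) ((\<lambda>z. q n (fst z)) -` {c}) = emeasure (\<gamma>' n) ((\<lambda>z. q n (fst z)) -` {c})" for c
      using *[OF \<gamma>(1)] *[OF \<gamma>'(1)] by simp
    show ?thesis
      by (rule glue_over_finite_partition[OF P m m fin law]) blast
  qed
  then have "\<forall>n. \<exists>\<Theta>. \<Theta> \<in> P2 \<and> distr \<Theta> borel fst = \<gamma> n \<and> distr \<Theta> borel snd = \<gamma>' n \<and>
      (AE z in \<Theta>. q n (fst (fst z)) = q n (fst (snd z)))" by blast
  from choice[OF this] obtain \<Theta> where \<Theta>: "\<And>n. \<Theta> n \<in> P2" "\<And>n. distr (\<Theta> n) borel fst = \<gamma> n" "\<And>n. distr (\<Theta> n) borel snd = \<gamma>' n"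
    "\<And>n. AE z in \<Theta> n. q n (fst (fst z)) = q n (fst (snd z))"
    by blast
  define C where "C = 2 * (\<integral>x. (norm x)\<^sup>2 \<partial>\<mu>1) + (\<integral>x. (norm x)\<^sup>2 \<partial>\<mu>2) + (\<integral>x. (norm x)\<^sup>2 \<partial>\<mu>3)"
  have moment: "(\<integral>z. (norm z)\<^sup>2 \<partial>\<rho>) = (\<integral>x. (norm x)\<^sup>2 \<partial>\<mu>) + (\<integral>x. (norm x)\<^sup>2 \<partial>\<nu>)" 
    if "\<rho> \<in> P2" "distr \<rho> borel fst = \<mu>" "distr \<rho> borel snd = \<nu>"
    for \<rho> :: "('b::euclidean_space \<times> 'c::euclidean_space) measure" and \<mu> \<nu>
  proof -
    have s: "square_integrable \<rho> fst" "square_integrable \<rho> snd"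
      using that(1) square_integrable_fst[of \<rho> "\<lambda>x. x"] square_integrable_snd[of \<rho> "\<lambda>x. x"] by (auto simp: P2_iff)
    then have [measurable]: "fst \<in> borel_measurable \<rho>" "snd \<in> borel_measurable \<rho>" by auto
    have "(\<integral>z. (norm z)\<^sup>2 \<partial>\<rho>) = (\<integral>z. (norm (fst z))\<^sup>2 + (norm (snd z))\<^sup>2 \<partial>\<rho>)"
      by (simp add: norm_prod_def)
    also have "\<dots> = (\<integral>z. (norm (fst z))\<^sup>2 \<partial>\<rho>) + (\<integral>z. (norm (snd z))\<^sup>2 \<partial>\<rho>)"
      using s by (intro Bochner_Integration.integral_add) auto
    also have "\<dots> = (\<integral>x. (norm x)\<^sup>2 \<partial>\<mu>) + (\<integral>x. (norm x)\<^sup>2 \<partial>\<nu>)"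
      unfolding that(2,3)[symmetric] by (simp add: integral_distr)
    finally show ?thesis .
  qed
  have bounded: "(\<integral>z. (norm z)\<^sup>2 \<partial>\<Theta> n) \<le> C" for n
    using moment[OF \<Theta>(1-3)[of n]] moment[of "\<gamma> n" \<mu>1 \<mu>2] moment[of "\<gamma>' n" \<mu>1 \<mu>3] \<gamma>(1)[of n] \<gamma>'(1)[of n]
    by (auto simp: plans_def C_def)
  obtain \<Omega> :: "real measure" and X X' and r :: "nat \<Rightarrow> nat" where
    \<Omega>: "prob_space \<Omega>" and r: "strict_mono r" and X: "\<And>n. X n \<in> borel_measurable \<Omega>" "X' \<in> borel_measurable \<Omega>"
    and law: "\<And>n. distr \<Omega> borel (X n) = \<Theta> (r n)" and conv: "AE \<omega> in \<Omega>. (\<lambda>n. X n \<omega>) \<longlonglongrightarrow> X' \<omega>"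
    by (rule skorohod_subsequence[of \<Theta> C, OF \<Theta>(1) bounded]) blast
  note [measurable] = X
  have r_lim: "filterlim r sequentially sequentially" using r by (rule filterlim_subseq)
  have X_si: "square_integrable \<Omega> (X n)" for n
    using square_integrable_of_law[OF X(1)] \<Theta>(1) by (simp add: law)
  define A A' B C where ABC: "A = (\<lambda>\<omega>. fst (fst (X' \<omega>)))" "A' = (\<lambda>\<omega>. fst (snd (X' \<omega>)))"
    "B = (\<lambda>\<omega>. snd (fst (X' \<omega>)))" "C = (\<lambda>\<omega>. snd (snd (X' \<omega>)))"
  have [measurable]: "A \<in> borel_measurable \<Omega>" "A' \<in> borel_measurable \<Omega>" "B \<in> borel_measurable \<Omega>" "C \<in> borel_measurable \<Omega>"
    unfolding ABC by measurable
  have law1: "distr \<Omega> borel (\<lambda>\<omega>. fst (X n \<omega>)) = \<gamma> (r n)" and law2: "distr \<Omega> borel (\<lambda>\<omega>. snd (X n \<omega>)) = \<gamma>' (r n)" for n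
    unfolding \<Theta>(2,3)[symmetric] law[symmetric] by (simp_all add: distr_distr o_def)
  have laws: "distr \<Omega> borel (\<lambda>\<omega>. fst (fst (X n \<omega>))) = \<mu>1" "distr \<Omega> borel (\<lambda>\<omega>. snd (fst (X n \<omega>))) = \<mu>2"
    "distr \<Omega> borel (\<lambda>\<omega>. fst (snd (X n \<omega>))) = \<mu>1" "distr \<Omega> borel (\<lambda>\<omega>. snd (snd (X n \<omega>))) = \<mu>3" for n
    using plansD(5,6)[OF \<gamma>(1)[of "r n"]] plansD(5,6)[OF \<gamma>'(1)[of "r n"]]
    unfolding law1[symmetric] law2[symmetric] by (simp_all add: distr_distr o_def)
  have convs: "AE \<omega> in \<Omega>. (\<lambda>n. fst (fst (X n \<omega>))) \<longlonglongrightarrow> A \<omega>" "AE \<omega> in \<Omega>. (\<lambda>n. snd (fst (X n \<omega>))) \<longlonglongrightarrow> B \<omega>"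
    "AE \<omega> in \<Omega>. (\<lambda>n. fst (snd (X n \<omega>))) \<longlonglongrightarrow> A' \<omega>" "AE \<omega> in \<Omega>. (\<lambda>n. snd (snd (X n \<omega>))) \<longlonglongrightarrow> C \<omega>"
  proof -
    show "AE \<omega> in \<Omega>. (\<lambda>n. fst (fst (X n \<omega>))) \<longlonglongrightarrow> A \<omega>"
      using conv unfolding ABC by eventually_elim (rule tendsto_fst[OF tendsto_fst])
    show "AE \<omega> in \<Omega>. (\<lambda>n. snd (fst (X n \<omega>))) \<longlonglongrightarrow> B \<omega>"
      using conv unfolding ABC by eventually_elim (rule tendsto_snd[OF tendsto_fst])
    show "AE \<omega> in \<Omega>. (\<lambda>n. fst (snd (X n \<omega>))) \<longlonglongrightarrow> A' \<omega>"
      using conv unfolding ABC by eventually_elim (rule tendsto_fst[OF tendsto_snd])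
    show "AE \<omega> in \<Omega>. (\<lambda>n. snd (snd (X n \<omega>))) \<longlonglongrightarrow> C \<omega>"
      using conv unfolding ABC by eventually_elim (rule tendsto_snd[OF tendsto_snd])
  qed
  have lawA: "distr \<Omega> borel A = \<mu>1" by (rule law_of_limit[OF \<Omega> _ _ laws(1) convs(1)]) measurable
  have lawB: "distr \<Omega> borel B = \<mu>2" by (rule law_of_limit[OF \<Omega> _ _ laws(2) convs(2)]) measurable
  have lawC: "distr \<Omega> borel C = \<mu>3" by (rule law_of_limit[OF \<Omega> _ _ laws(4) convs(4)]) measurable
  have si: "square_integrable \<Omega> A" "square_integrable \<Omega> B" "square_integrable \<Omega> C"
    using square_integrable_of_law[of A \<Omega>] square_integrable_of_law[of B \<Omega>] square_integrable_of_law[of C \<Omega>] assms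
    by (simp_all add: lawA lawB lawC)
  have costAB: "(\<integral>\<omega>. (norm (A \<omega> - B \<omega>))\<^sup>2 \<partial>\<Omega>) \<le> (W2 \<mu>1 \<mu>2)\<^sup>2"
  proof (rule square_integrable_fatou(2))
    show "square_integrable \<Omega> (\<lambda>\<omega>. fst (fst (X n \<omega>)) - snd (fst (X n \<omega>)))" for n
      by (intro square_integrable_diff square_integrable_fst square_integrable_snd X_si)
    show "AE \<omega> in \<Omega>. (\<lambda>n. fst (fst (X n \<omega>)) - snd (fst (X n \<omega>))) \<longlonglongrightarrow> A \<omega> - B \<omega>"
      using convs(1,2) by eventually_elim (rule tendsto_diff)
    show "(\<integral>\<omega>. (norm (fst (fst (X n \<omega>)) - snd (fst (X n \<omega>))))\<^sup>2 \<partial>\<Omega>) \<le> (W2 \<mu>1 \<mu>2)\<^sup>2 + inverse (real (Suc (r n)))" for n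
      using \<gamma>(2)[of "r n"] unfolding law1[symmetric] by (simp add: integral_distr case_prod_beta)
    show "(\<lambda>n. (W2 \<mu>1 \<mu>2)\<^sup>2 + inverse (real (Suc (r n)))) \<longlonglongrightarrow> (W2 \<mu>1 \<mu>2)\<^sup>2"
      using tendsto_add[OF tendsto_const filterlim_compose[OF LIMSEQ_inverse_real_of_nat r_lim]] by simp
  qed measurable
  have costAC: "(\<integral>\<omega>. (norm (A' \<omega> - C \<omega>))\<^sup>2 \<partial>\<Omega>) \<le> (W2 \<mu>1 \<mu>3)\<^sup>2"
  proof (rule square_integrable_fatou(2))
    show "square_integrable \<Omega> (\<lambda>\<omega>. fst (snd (X n \<omega>)) - snd (snd (X n \<omega>)))" for n
      by (intro square_integrable_diff square_integrable_fst square_integrable_snd X_si)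
    show "AE \<omega> in \<Omega>. (\<lambda>n. fst (snd (X n \<omega>)) - snd (snd (X n \<omega>))) \<longlonglongrightarrow> A' \<omega> - C \<omega>"
      using convs(3,4) by eventually_elim (rule tendsto_diff)
    show "(\<integral>\<omega>. (norm (fst (snd (X n \<omega>)) - snd (snd (X n \<omega>))))\<^sup>2 \<partial>\<Omega>) \<le> (W2 \<mu>1 \<mu>3)\<^sup>2 + inverse (real (Suc (r n)))" for n
      using \<gamma>'(2)[of "r n"] unfolding law2[symmetric] by (simp add: integral_distr case_prod_beta)
    show "(\<lambda>n. (W2 \<mu>1 \<mu>3)\<^sup>2 + inverse (real (Suc (r n)))) \<longlonglongrightarrow> (W2 \<mu>1 \<mu>3)\<^sup>2"
      using tendsto_add[OF tendsto_const filterlim_compose[OF LIMSEQ_inverse_real_of_nat r_lim]] by simp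
  qed measurable
  have "square_integrable \<Omega> (\<lambda>\<omega>. A \<omega> - A' \<omega>)" "(\<integral>\<omega>. (norm (A \<omega> - A' \<omega>))\<^sup>2 \<partial>\<Omega>) \<le> 0"
  proof -
    have 1: "square_integrable \<Omega> (\<lambda>\<omega>. fst (fst (X n \<omega>)) - fst (snd (X n \<omega>)))" for n
      by (intro square_integrable_diff square_integrable_fst square_integrable_snd X_si)
    have 2: "AE \<omega> in \<Omega>. (\<lambda>n. fst (fst (X n \<omega>)) - fst (snd (X n \<omega>))) \<longlonglongrightarrow> A \<omega> - A' \<omega>"
      using convs(1,3) by eventually_elim (rule tendsto_diff)
    \<comment> \<open>Both copies are compared with their common value under \<open>q (r n)\<close>.\<close>
    have 3: "(\<integral>\<omega>. (norm (fst (fst (X n \<omega>)) - fst (snd (X n \<omega>))))\<^sup>2 \<partial>\<Omega>) \<le> 2 * e (r n) + 2 * e (r n)" for n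
    proof -
      let ?d = "\<lambda>x. q (r n) x - x"
      have same: "AE \<omega> in \<Omega>. q (r n) (fst (fst (X n \<omega>))) = q (r n) (fst (snd (X n \<omega>)))"
        using \<Theta>(4)[of "r n"] unfolding law[symmetric] by (subst (asm) AE_distr_iff) auto
      have err: "square_integrable \<Omega> (\<lambda>\<omega>. ?d (Y \<omega>)) \<and> (\<integral>\<omega>. (norm (?d (Y \<omega>)))\<^sup>2 \<partial>\<Omega>) = e (r n)"
        if "distr \<Omega> borel Y = \<mu>1" and [measurable]: "Y \<in> borel_measurable \<Omega>" for Y
        using q_err(1)[of "r n"] unfolding e_def that(1)[symmetric] 
        by (simp add: square_integrable_distr integral_distr)
      note err1 = err[OF laws(1)[of n]] and err2 = err[OF laws(3)[of n]]
      have "(\<integral>\<omega>. (norm (fst (fst (X n \<omega>)) - fst (snd (X n \<omega>))))\<^sup>2 \<partial>\<Omega>) \<le>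
        (\<integral>\<omega>. 2 * (norm (?d (fst (fst (X n \<omega>)))))\<^sup>2 + 2 * (norm (?d (fst (snd (X n \<omega>)))))\<^sup>2 \<partial>\<Omega>)"
      proof (rule integral_mono_AE)
        show "AE \<omega> in \<Omega>. (norm (fst (fst (X n \<omega>)) - fst (snd (X n \<omega>))))\<^sup>2 \<le>
          2 * (norm (?d (fst (fst (X n \<omega>)))))\<^sup>2 + 2 * (norm (?d (fst (snd (X n \<omega>)))))\<^sup>2"
          using same
        proof eventually_elim
          case (elim \<omega>)
          then show ?case
            using norm_add_square_le[of "- ?d (fst (fst (X n \<omega>)))" "?d (fst (snd (X n \<omega>)))"] by (simp add: norm_minus_commute)
        qed
      qed (use 1 err1 err2 in \<open>auto simp: square_integrable_def\<close>)
      also have "\<dots> = 2 * e (r n) + 2 * e (r n)"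
        using err1 err2 by (subst Bochner_Integration.integral_add) (auto simp: square_integrable_def)
      finally show ?thesis .
    qed
    have 4: "(\<lambda>n. 2 * e (r n) + 2 * e (r n)) \<longlonglongrightarrow> 0"
      using tendsto_add[OF tendsto_mult_left tendsto_mult_left, OF filterlim_compose[OF q_err(2) r_lim] filterlim_compose[OF q_err(2) r_lim], of 2 2]
      by simp
    show "square_integrable \<Omega> (\<lambda>\<omega>. A \<omega> - A' \<omega>)" "(\<integral>\<omega>. (norm (A \<omega> - A' \<omega>))\<^sup>2 \<partial>\<Omega>) \<le> 0"
      by (rule square_integrable_fatou[OF 1 _ 2 3 4], measurable)+
  qed
  then have "AE \<omega> in \<Omega>. (norm (A \<omega> - A' \<omega>))\<^sup>2 = 0"
    by (subst integral_nonneg_eq_0_iff_AE[symmetric]) (auto intro!: antisym Bochner_Integration.integral_nonneg)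
  then have eq: "AE \<omega> in \<Omega>. A' \<omega> = A \<omega>" by eventually_elim simp
  have costAC': "(\<integral>\<omega>. (norm (A \<omega> - C \<omega>))\<^sup>2 \<partial>\<Omega>) \<le> (W2 \<mu>1 \<mu>3)\<^sup>2"
    using costAC by (subst integral_cong_AE[where g="\<lambda>\<omega>. (norm (A' \<omega> - C \<omega>))\<^sup>2"]) (use eq in \<open>auto elim: eventually_mono\<close>)
  define M where "M = distr \<Omega> borel (\<lambda>\<omega>. (A \<omega>, B \<omega>, C \<omega>))"
  have AB: "distr M borel (\<lambda>(x1, x2, x3). (x1, x2)) = distr \<Omega> borel (\<lambda>\<omega>. (A \<omega>, B \<omega>))"
    and AC: "distr M borel (\<lambda>(x1, x2, x3). (x1, x3)) = distr \<Omega> borel (\<lambda>\<omega>. (A \<omega>, C \<omega>))"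
    unfolding M_def case_prod_beta by (simp_all add: distr_distr o_def)
  show ?thesis
  proof
    show "M \<in> P2" unfolding M_def using si by (intro law_in_P2 \<Omega>) (simp add: square_integrable_Pair_iff)
    show "distr M borel (\<lambda>(x1, x2, x3). (x1, x2)) \<in> opt_plans \<mu>1 \<mu>2"
      unfolding AB using law_in_plans[OF \<Omega> si(1,2)] costAB cost_law[of A \<Omega> B]
      by (intro opt_plansI) (simp_all add: lawA lawB)
    show "distr M borel (\<lambda>(x1, x2, x3). (x1, x3)) \<in> opt_plans \<mu>1 \<mu>3"
      unfolding AC using law_in_plans[OF \<Omega> si(1,3)] costAC' cost_law[of A \<Omega> C]
      by (intro opt_plansI) (simp_all add: lawA lawC)
  qed
qed

lemma opt_plans_nonempty:
  assumes "\<mu> \<in> P2" "\<nu> \<in> P2"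
  shows "opt_plans \<mu> \<nu> \<noteq> {}"
  using optimal_gluing[OF assms(1) assms(2) assms(2)] by blast

text \<open>Every generalised geodesic is an acceleration-free curve for the plan between its second and third marginals, so
  only the existence of the measure on triples is at stake.\<close>

lemma acceleration_free_imp_generalised:
  fixes F :: "'a::euclidean_space measure \<Rightarrow> real"
  assumes "acceleration_free_convex l F"
  shows "generalised_geodesically_convex l F"
  unfolding generalised_geodesically_convex_def
proof (intro ballI)
  fix \<mu>1 \<mu>2 \<mu>3 :: "'a measure" assume P2: "\<mu>1 \<in> P2" "\<mu>2 \<in> P2" "\<mu>3 \<in> P2"
  obtain M :: "('a \<times> 'a \<times> 'a) measure" where M: "M \<in> P2"
    "distr M borel (\<lambda>(x1, x2, x3). (x1, x2)) \<in> opt_plans \<mu>1 \<mu>2"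
    "distr M borel (\<lambda>(x1, x2, x3). (x1, x3)) \<in> opt_plans \<mu>1 \<mu>3"
    by (rule optimal_gluing[OF P2])
  have si: "square_integrable M (\<lambda>z. z)" and prob: "prob_space M" and sets [measurable_cong]: "sets M = sets borel"
    using M(1) by (auto simp: P2_iff)
  have laws: "distr M borel (\<lambda>z. fst (snd z)) = \<mu>2" "distr M borel (\<lambda>z. snd (snd z)) = \<mu>3"
    using M(2,3) by (auto simp: opt_plans_def plans_def case_prod_beta distr_distr o_def)
  define \<gamma> where "\<gamma> = distr M borel (\<lambda>z. (fst (snd z), snd (snd z)))"
  have \<gamma>: "\<gamma> \<in> plans \<mu>2 \<mu>3"
    unfolding \<gamma>_def laws[symmetric] using si by (intro law_in_plans prob) auto
  have "F (distr M borel (\<lambda>(x1, x2, x3). (1 - t) *\<^sub>R x2 + t *\<^sub>R x3)) \<le>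
           (1 - t) * F \<mu>2 + t * F \<mu>3 - l / 2 * t * (1 - t) * (\<integral>(x1, x2, x3). (norm (x2 - x3))\<^sup>2 \<partial>M)"
    if "t \<in> {0..1}" for t
  proof -
    have "F (distr \<gamma> borel (\<lambda>(x1, x2). (1 - t) *\<^sub>R x1 + t *\<^sub>R x2)) \<le>
          (1 - t) * F \<mu>2 + t * F \<mu>3 - l / 2 * t * (1 - t) * (\<integral>(x1, x2). (norm (x1 - x2))\<^sup>2 \<partial>\<gamma>)"
      using assms P2 \<gamma> that unfolding acceleration_free_convex_def by blast
    then show ?thesis
      unfolding \<gamma>_def case_prod_beta by (simp add: distr_distr integral_distr o_def)
  qed
  with M show "\<exists>M \<in> (P2 :: ('a \<times> 'a \<times> 'a) measure set).
        distr M borel (\<lambda>(x1, x2, x3). (x1, x2)) \<in> opt_plans \<mu>1 \<mu>2 \<and>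
        distr M borel (\<lambda>(x1, x2, x3). (x1, x3)) \<in> opt_plans \<mu>1 \<mu>3 \<and>
        (\<forall>t\<in>{0..1}. F (distr M borel (\<lambda>(x1, x2, x3). (1 - t) *\<^sub>R x2 + t *\<^sub>R x3)) \<le>
           (1 - t) * F \<mu>2 + t * F \<mu>3 - l / 2 * t * (1 - t) * (\<integral>(x1, x2, x3). (norm (x2 - x3))\<^sup>2 \<partial>M))"
    by blast
qed

text \<open>With the base measure equal to the starting measure the first two coordinates agree almost surely, so the plan
  that carries the curve is the optimal plan from the base measure.\<close>

lemma generalised_imp_geodesically:
  fixes F :: "'a::euclidean_space measure \<Rightarrow> real"
  assumes "generalised_geodesically_convex l F"
  shows "geodesically_convex l F"
  unfolding geodesically_convex_def
proof (intro ballI)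
  fix \<mu>1 \<mu>2 :: "'a measure" assume P2: "\<mu>1 \<in> P2" "\<mu>2 \<in> P2"
  obtain M :: "('a \<times> 'a \<times> 'a) measure" where M: "M \<in> P2"
    "distr M borel (\<lambda>(x1, x2, x3). (x1, x2)) \<in> opt_plans \<mu>1 \<mu>1"
    "distr M borel (\<lambda>(x1, x2, x3). (x1, x3)) \<in> opt_plans \<mu>1 \<mu>2"
    and conv: "\<And>t. t \<in> {0..1} \<Longrightarrow> F (distr M borel (\<lambda>(x1, x2, x3). (1 - t) *\<^sub>R x2 + t *\<^sub>R x3)) \<le>
           (1 - t) * F \<mu>1 + t * F \<mu>2 - l / 2 * t * (1 - t) * (\<integral>(x1, x2, x3). (norm (x2 - x3))\<^sup>2 \<partial>M)"
    using assms P2 unfolding generalised_geodesically_convex_def by blast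
  have si: "square_integrable M (\<lambda>z. z)" and prob: "prob_space M" and sets [measurable_cong]: "sets M = sets borel"
    using M(1) by (auto simp: P2_iff)
  have "(\<integral>z. (norm (fst z - fst (snd z)))\<^sup>2 \<partial>M) = 0"
    using M(2) W2_self[OF P2(1)] by (simp add: opt_plans_def case_prod_beta integral_distr)
  moreover have "integrable M (\<lambda>z. (norm (fst z - fst (snd z)))\<^sup>2)"
    by (intro square_integrableD(2) square_integrable_diff[OF square_integrable_fst[OF si] square_integrable_fst[OF square_integrable_snd[OF si]]])
  ultimately have "AE z in M. (norm (fst z - fst (snd z)))\<^sup>2 = 0"
    by (subst integral_nonneg_eq_0_iff_AE[symmetric]) auto
  then have eq: "AE z in M. fst z = fst (snd z)" by eventually_elim simp
  define \<gamma> where "\<gamma> = distr M borel (\<lambda>(x1, x2, x3). (x1, x3))"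
  have \<gamma>: "\<gamma> \<in> opt_plans \<mu>1 \<mu>2" using M(3) by (simp add: \<gamma>_def)
  have curve: "distr \<gamma> borel (\<lambda>(x1, x2). (1 - t) *\<^sub>R x1 + t *\<^sub>R x2) = 
      distr M borel (\<lambda>(x1, x2, x3). (1 - t) *\<^sub>R x2 + t *\<^sub>R x3)" for t
    unfolding \<gamma>_def case_prod_beta 
    by (simp add: distr_distr o_def) (intro distr_cong_AE, use eq in auto)
  have "(W2 \<mu>1 \<mu>2)\<^sup>2 = (\<integral>z. (norm (fst z - snd (snd z)))\<^sup>2 \<partial>M)"
    using \<gamma> by (simp add: opt_plans_def \<gamma>_def case_prod_beta integral_distr)
  also have "\<dots> = (\<integral>(x1, x2, x3). (norm (x2 - x3))\<^sup>2 \<partial>M)"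
    unfolding case_prod_beta by (intro integral_cong_AE) (use eq in auto)
  finally have cost: "(W2 \<mu>1 \<mu>2)\<^sup>2 = (\<integral>(x1, x2, x3). (norm (x2 - x3))\<^sup>2 \<partial>M)" .
  show "\<exists>m. geodesic_between \<mu>1 \<mu>2 m \<and>
     (\<forall>t\<in>{0..1}. F (m t) \<le> (1 - t) * F \<mu>1 + t * F \<mu>2 - l / 2 * t * (1 - t) * (W2 \<mu>1 \<mu>2)\<^sup>2)"
    unfolding geodesic_between_def cost
  proof (intro exI[of _ "\<lambda>t. distr \<gamma> borel (\<lambda>(x1, x2). (1 - t) *\<^sub>R x1 + t *\<^sub>R x2)"] conjI ballI bexI[OF _ \<gamma>])
  qed (simp_all only: curve conv)
qed

section \<open>Differentiable functionals are continuous\<close>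

lemma abs_inner_le_weighted_squares:
  fixes a b :: "'a::real_inner"
  assumes "\<kappa> > 0"
  shows "\<bar>a \<bullet> b\<bar> \<le> \<kappa> / 2 * (norm a)\<^sup>2 + (norm b)\<^sup>2 / (2 * \<kappa>)"
proof -
  have "0 \<le> (\<kappa> * norm a - norm b)\<^sup>2 / (2 * \<kappa>)" using assms by simp
  also have "\<dots> = \<kappa> / 2 * (norm a)\<^sup>2 + (norm b)\<^sup>2 / (2 * \<kappa>) - norm a * norm b"
    using assms by (simp add: power2_diff field_simps power2_eq_square)
  finally show ?thesis using Cauchy_Schwarz_ineq2[of a b] by linarith
qed

text \<open>The linear term is bounded by \<open>\<kappa> / 2\<close> times the squared \<open>L\<^sup>2\<close> norm of \<open>\<xi>\<close> plus \<open>1 / (2 \<kappa>)\<close> times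
  the squared distance; \<open>\<kappa>\<close> is fixed first to make the former at most \<open>e / 2\<close>. An optimal plan must exist for
  the definition of differentiability to say anything about \<open>F \<nu>\<close>.\<close>

lemma W2_differentiable_imp_continuous:
  fixes F :: "'a::euclidean_space measure \<Rightarrow> real"
  assumes "W2_differentiable F \<mu>" "\<mu> \<in> P2" "e > 0"
  obtains \<delta> where "\<delta> > 0" "\<And>\<nu>. \<nu> \<in> P2 \<Longrightarrow> W2 \<mu> \<nu> < \<delta> \<Longrightarrow> \<bar>F \<nu> - F \<mu>\<bar> < e"
proof -
  obtain \<xi> where "\<xi> \<in> W2_diff F \<mu>" using assms(1) by (auto simp: W2_differentiable_def)
  then have \<xi>: "\<xi> \<in> borel_measurable \<mu>" "integrable \<mu> (\<lambda>x. (norm (\<xi> x))\<^sup>2)"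
    and diff: "\<And>\<epsilon>. \<epsilon> > 0 \<Longrightarrow> \<exists>\<delta>>0. \<forall>\<nu>\<in>P2. W2 \<mu> \<nu> < \<delta> \<longrightarrow> (\<forall>\<gamma>\<in>opt_plans \<mu> \<nu>.
        \<bar>F \<nu> - F \<mu> - (\<integral>(x1, x2). \<xi> x1 \<bullet> (x2 - x1) \<partial>\<gamma>)\<bar> \<le> \<epsilon> * W2 \<mu> \<nu>)"
    unfolding W2_diff_def L2_def by blast+
  from diff[of 1] obtain \<delta>0 where \<delta>0: "\<delta>0 > 0" "\<And>\<nu> \<gamma>. \<nu> \<in> P2 \<Longrightarrow> W2 \<mu> \<nu> < \<delta>0 \<Longrightarrow> \<gamma> \<in> opt_plans \<mu> \<nu> \<Longrightarrow>
        \<bar>F \<nu> - F \<mu> - (\<integral>(x1, x2). \<xi> x1 \<bullet> (x2 - x1) \<partial>\<gamma>)\<bar> \<le> W2 \<mu> \<nu>"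
    by auto
  define S where "S = (\<integral>x. (norm (\<xi> x))\<^sup>2 \<partial>\<mu>)"
  have S: "S \<ge> 0" unfolding S_def by (rule Bochner_Integration.integral_nonneg) simp
  define \<kappa> where "\<kappa> = e / (S + 1)"
  have \<kappa>: "\<kappa> > 0" using assms(3) S by (simp add: \<kappa>_def)
  have \<kappa>S: "\<kappa> * S \<le> e" using assms(3) S by (simp add: \<kappa>_def field_simps)
  \<comment> \<open>The three error terms are at most \<open>e / 2\<close>, \<open>e / 4\<close> and \<open>e / 8\<close>.\<close>
  define \<delta> where "\<delta> = min \<delta>0 (min (e / 8) (sqrt (e * \<kappa> / 2)))"
  show ?thesis
  proof
    show "\<delta> > 0" using \<delta>0 assms(3) \<kappa> by (simp add: \<delta>_def)
    fix \<nu> :: "'a measure" assume \<nu>: "\<nu> \<in> P2" and W: "W2 \<mu> \<nu> < \<delta>"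
    obtain \<gamma> where \<gamma>: "\<gamma> \<in> opt_plans \<mu> \<nu>" using opt_plans_nonempty[OF assms(2) \<nu>] by blast
    then have plan: "\<gamma> \<in> plans \<mu> \<nu>" and opt: "(\<integral>z. (norm (fst z - snd z))\<^sup>2 \<partial>\<gamma>) = (W2 \<mu> \<nu>)\<^sup>2"
      by (simp_all add: opt_plans_def case_prod_beta')
    note pl = plansD[OF plan]
    have W0: "0 \<le> W2 \<mu> \<nu>" using plan by (intro W2_nonneg) auto
    have [measurable]: "fst \<in> borel_measurable \<gamma>" "snd \<in> borel_measurable \<gamma>"
      using pl(3,4) by (simp_all add: square_integrable_def)
    have "sets \<mu> = sets borel" using assms(2) by (simp add: P2_def)
    then have [measurable]: "\<xi> \<in> borel_measurable borel" using \<xi>(1) measurable_cong_sets by blast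
    have int1: "integrable \<gamma> (\<lambda>z. (norm (\<xi> (fst z)))\<^sup>2)" and S': "(\<integral>z. (norm (\<xi> (fst z)))\<^sup>2 \<partial>\<gamma>) = S"
      using \<xi>(2) unfolding S_def pl(5)[symmetric] by (simp_all add: integrable_distr_eq integral_distr)
    have int2: "integrable \<gamma> (\<lambda>z. (norm (snd z - fst z))\<^sup>2)"
      by (intro square_integrableD(2) square_integrable_diff pl)
    let ?g = "\<lambda>z. \<kappa> / 2 * (norm (\<xi> (fst z)))\<^sup>2 + (norm (snd z - fst z))\<^sup>2 / (2 * \<kappa>)"
    have int: "integrable \<gamma> ?g" using int1 int2 by simp
    have "\<bar>\<integral>z. \<xi> (fst z) \<bullet> (snd z - fst z) \<partial>\<gamma>\<bar> \<le> (\<integral>z. \<bar>\<xi> (fst z) \<bullet> (snd z - fst z)\<bar> \<partial>\<gamma>)"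
      by (rule integral_abs_bound)
    also have "\<dots> \<le> (\<integral>z. ?g z \<partial>\<gamma>)"
    proof (rule integral_mono)
      have "integrable \<gamma> (\<lambda>z. \<xi> (fst z) \<bullet> (snd z - fst z))"
        using abs_inner_le_weighted_squares[OF \<kappa>] by (intro Bochner_Integration.integrable_bound[OF int]) (auto intro!: AE_I2 order_trans[OF _ abs_ge_self])
      then show "integrable \<gamma> (\<lambda>z. \<bar>\<xi> (fst z) \<bullet> (snd z - fst z)\<bar>)" by simp
    qed (use int abs_inner_le_weighted_squares[OF \<kappa>] in auto)
    also have "\<dots> = \<kappa> / 2 * S + (W2 \<mu> \<nu>)\<^sup>2 / (2 * \<kappa>)"
      using int1 int2 by (simp add: S' opt[symmetric] norm_minus_commute)
    finally have 1: "\<bar>\<integral>z. \<xi> (fst z) \<bullet> (snd z - fst z) \<partial>\<gamma>\<bar> \<le> \<kappa> / 2 * S + (W2 \<mu> \<nu>)\<^sup>2 / (2 * \<kappa>)" .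
    have "(W2 \<mu> \<nu>)\<^sup>2 \<le> (sqrt (e * \<kappa> / 2))\<^sup>2"
      using W W0 by (intro power_mono) (auto simp: \<delta>_def)
    then have "(W2 \<mu> \<nu>)\<^sup>2 \<le> e * \<kappa> / 2" using assms(3) \<kappa> by simp
    then have "(W2 \<mu> \<nu>)\<^sup>2 / (2 * \<kappa>) \<le> e / 4" using \<kappa> by (simp add: field_simps)
    moreover have "W2 \<mu> \<nu> < e / 8" "W2 \<mu> \<nu> < \<delta>0" using W by (auto simp: \<delta>_def)
    moreover have "\<bar>F \<nu> - F \<mu> - (\<integral>z. \<xi> (fst z) \<bullet> (snd z - fst z) \<partial>\<gamma>)\<bar> \<le> W2 \<mu> \<nu>"
      using \<delta>0(2)[OF \<nu> _ \<gamma>] W by (simp add: \<delta>_def case_prod_beta')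
    ultimately show "\<bar>F \<nu> - F \<mu>\<bar> < e" using 1 \<kappa>S assms(3) by linarith
  qed
qed

lemma W2_differentiable_imp_tendsto_law:
  fixes U :: "nat \<Rightarrow> 'b \<Rightarrow> 'a::euclidean_space"
  assumes M: "prob_space M" and F: "\<forall>\<mu>\<in>P2. W2_differentiable F \<mu>"
    and U: "\<And>n. U n \<in> borel_measurable M" "U' \<in> borel_measurable M"
    and conv: "AE x in M. (\<lambda>n. U n x) \<longlonglongrightarrow> U' x"
    and le: "\<And>n. AE x in M. (norm (U n x))\<^sup>2 \<le> g x" and g: "integrable M g"
  shows "(\<lambda>n. F (distr M borel (U n))) \<longlonglongrightarrow> F (distr M borel U')"
proof (rule tendstoI)
  fix e :: real assume e: "e > 0"
  note si = square_integrable_dominated(1,2)[OF U conv le g]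
  note [measurable] = U
  have P2: "distr M borel U' \<in> P2" "distr M borel (U n) \<in> P2" for n
    by (intro law_in_P2 M si)+
  obtain \<delta> where \<delta>: "\<delta> > 0" "\<And>\<nu>. \<nu> \<in> P2 \<Longrightarrow> W2 (distr M borel U') \<nu> < \<delta> \<Longrightarrow> \<bar>F \<nu> - F (distr M borel U')\<bar> < e"
    by (rule W2_differentiable_imp_continuous[OF _ P2(1) e, of F]) (use F P2(1) in blast)+
  have "(\<lambda>n. \<integral>x. (norm (U' x - U n x))\<^sup>2 \<partial>M) \<longlonglongrightarrow> (\<integral>x. (norm (0::'a))\<^sup>2 \<partial>M)"
  proof (rule square_integrable_dominated(3)[where g="\<lambda>x. 2 * (norm (U' x))\<^sup>2 + 2 * g x"])
    show "AE x in M. (\<lambda>n. U' x - U n x) \<longlonglongrightarrow> 0"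
      using conv
    proof eventually_elim
      case (elim x)
      then show ?case using tendsto_diff[OF tendsto_const[of "U' x"] elim] by simp
    qed
    show "AE x in M. (norm (U' x - U n x))\<^sup>2 \<le> 2 * (norm (U' x))\<^sup>2 + 2 * g x" for n
      using le[of n]
    proof eventually_elim
      case (elim x)
      then show ?case using norm_add_square_le[of "U' x" "- U n x"] by simp
    qed
    show "integrable M (\<lambda>x. 2 * (norm (U' x))\<^sup>2 + 2 * g x)" using si(2) g by (simp add: square_integrable_def)
  qed (use U in measurable)
  then have "\<forall>\<^sub>F n in sequentially. (\<integral>x. (norm (U' x - U n x))\<^sup>2 \<partial>M) < \<delta>\<^sup>2"
    by (rule order_tendstoD(2)) (use \<delta>(1) in simp)
  then show "\<forall>\<^sub>F n in sequentially. dist (F (distr M borel (U n))) (F (distr M borel U')) < e"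
  proof eventually_elim
    case (elim n)
    have "(W2 (distr M borel U') (distr M borel (U n)))\<^sup>2 < \<delta>\<^sup>2"
      using W2_square_le[OF law_in_plans[OF M si(2) si(1)[of n]]] elim unfolding cost_law[OF U(2) U(1)] by simp
    then have "W2 (distr M borel U') (distr M borel (U n)) < \<delta>"
      by (rule power2_less_imp_less) (use \<delta>(1) in simp)
    then show ?case using \<delta>(2)[OF P2(2)] by (simp add: dist_real_def)
  qed
qed

section \<open>Plans to the nearest point\<close>

text \<open>For any plan the squared displacement is at least the squared distance of the end point to the finite
  range \<open>S\<close> of \<open>X\<close>, and the integral of the latter depends on the second marginal only. The joint law of
  \<open>X\<close> and \<open>Y\<close> attains this bound. Any other optimal plan attains it almost surely, so it
  sends the end point back to its nearest point of \<open>S\<close>, which is unique; hence it is the same plan.\<close>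

lemma nearest_point_plan:
  fixes X Y :: "'b \<Rightarrow> 'a::euclidean_space"
  assumes M: "prob_space M" and X: "simple_function M X" and Y: "simple_function M Y"
    and near: "\<And>\<omega> \<omega>'. \<omega> \<in> space M \<Longrightarrow> \<omega>' \<in> space M \<Longrightarrow> X \<omega> \<noteq> X \<omega>' \<Longrightarrow> dist (Y \<omega>) (X \<omega>) < dist (Y \<omega>) (X \<omega>')"
  shows "opt_plans (distr M borel X) (distr M borel Y) = {distr M borel (\<lambda>\<omega>. (X \<omega>, Y \<omega>))}"
    and "(W2 (distr M borel X) (distr M borel Y))\<^sup>2 = (\<integral>\<omega>. (norm (X \<omega> - Y \<omega>))\<^sup>2 \<partial>M)"
proof -
  interpret prob_space M by fact
  have [measurable]: "X \<in> borel_measurable M" "Y \<in> borel_measurable M"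
    using X Y by (auto intro: borel_measurable_simple_function)
  note siX = simple_function_square_integrable[OF M X] and siY = simple_function_square_integrable[OF M Y]
  define S R where "S = X ` space M" and "R = Y ` space M"
  have S: "finite S" and R: "finite R" using simple_functionD(1)[OF X] simple_functionD(1)[OF Y] by (auto simp: S_def R_def)
  have [measurable]: "S \<in> sets borel" "R \<in> sets borel"
    by (rule borel_closed[OF finite_imp_closed[OF S]], rule borel_closed[OF finite_imp_closed[OF R]])
  have infdist: "infdist (Y \<omega>) S = dist (Y \<omega>) (X \<omega>)" if "\<omega> \<in> space M" for \<omega>
  proof (rule antisym)
    show "infdist (Y \<omega>) S \<le> dist (Y \<omega>) (X \<omega>)" using that by (intro infdist_le) (simp add: S_def)
    have "S \<noteq> {}" using that by (auto simp: S_def)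
    moreover have "dist (Y \<omega>) (X \<omega>) \<le> dist (Y \<omega>) p" if "p \<in> S" for p
      using near[OF \<open>\<omega> \<in> space M\<close>] that by (force simp: S_def intro: less_imp_le)
    ultimately show "dist (Y \<omega>) (X \<omega>) \<le> infdist (Y \<omega>) S"
      by (simp add: infdist_notempty) (intro cINF_greatest)
  qed
  define d where "d y = (infdist y S)\<^sup>2" for y
  have [measurable]: "d \<in> borel_measurable borel"
    unfolding d_def by (intro borel_measurable_continuous_onI continuous_intros)
  define c where "c = (\<integral>\<omega>. (norm (X \<omega> - Y \<omega>))\<^sup>2 \<partial>M)"
  have d_Y: "d (Y \<omega>) = (norm (X \<omega> - Y \<omega>))\<^sup>2" if "\<omega> \<in> space M" for \<omega>
    using infdist[OF that] by (simp add: d_def dist_norm norm_minus_commute)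
  have int_d: "integrable (distr M borel Y) d" "(\<integral>y. d y \<partial>distr M borel Y) = c"
  proof -
    have "integrable M (\<lambda>\<omega>. (norm (X \<omega> - Y \<omega>))\<^sup>2)"
      by (intro square_integrableD(2) square_integrable_diff siX siY)
    then show "integrable (distr M borel Y) d" 
      by (simp add: integrable_distr_eq d_Y cong: Bochner_Integration.integrable_cong)
    show "(\<integral>y. d y \<partial>distr M borel Y) = c"
      by (simp add: integral_distr c_def d_Y cong: Bochner_Integration.integral_cong)
  qed
  have plan: 
    "AE z in \<gamma>. fst z \<in> S" "AE z in \<gamma>. snd z \<in> R" "AE z in \<gamma>. d (snd z) \<le> (norm (fst z - snd z))\<^sup>2"
    "integrable \<gamma> (\<lambda>z. d (snd z))" "(\<integral>z. d (snd z) \<partial>\<gamma>) = c" "integrable \<gamma> (\<lambda>z. (norm (fst z - snd z))\<^sup>2)"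
    "fst \<in> borel_measurable \<gamma>" "snd \<in> borel_measurable \<gamma>"
    if \<gamma>: "\<gamma> \<in> plans (distr M borel X) (distr M borel Y)" for \<gamma>
  proof -
    note pl = plansD[OF \<gamma>]
    show m [measurable]: "fst \<in> borel_measurable \<gamma>" "snd \<in> borel_measurable \<gamma>"
      using pl(3,4) by (simp_all add: square_integrable_def)
    have "AE x in distr M borel X. x \<in> S" by (subst AE_distr_iff) (simp_all, auto simp: S_def)
    then show 1: "AE z in \<gamma>. fst z \<in> S" unfolding pl(5)[symmetric] by (subst (asm) AE_distr_iff) auto
    have "AE x in distr M borel Y. x \<in> R" by (subst AE_distr_iff) (simp_all, auto simp: R_def)
    then show "AE z in \<gamma>. snd z \<in> R" unfolding pl(6)[symmetric] by (subst (asm) AE_distr_iff) auto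
    show "AE z in \<gamma>. d (snd z) \<le> (norm (fst z - snd z))\<^sup>2"
      using 1 
    proof eventually_elim
      case (elim z)
      then have "infdist (snd z) S \<le> norm (fst z - snd z)"
        using infdist_le[of "fst z" S "snd z"] by (simp add: dist_norm norm_minus_commute)
      then show ?case unfolding d_def by (intro power_mono infdist_nonneg)
    qed
    show "integrable \<gamma> (\<lambda>z. d (snd z))" "(\<integral>z. d (snd z) \<partial>\<gamma>) = c"
      using int_d unfolding pl(6)[symmetric] by (simp_all add: integrable_distr_eq integral_distr)
    show "integrable \<gamma> (\<lambda>z. (norm (fst z - snd z))\<^sup>2)"
      by (intro square_integrableD(2) square_integrable_diff pl)
  qed
  have P2: "distr M borel X \<in> P2" "distr M borel Y \<in> P2" by (intro law_in_P2 M siX siY)+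
  have ge: "c \<le> (W2 (distr M borel X) (distr M borel Y))\<^sup>2"
  proof (rule W2_square_ge[OF P2])
    fix \<gamma> assume \<gamma>: "\<gamma> \<in> plans (distr M borel X) (distr M borel Y)"
    show "c \<le> (\<integral>(x1, x2). (norm (x1 - x2))\<^sup>2 \<partial>\<gamma>)"
      unfolding case_prod_beta' plan(5)[OF \<gamma>, symmetric] by (intro integral_mono_AE plan \<gamma>)
  qed
  have XY: "distr M borel (\<lambda>\<omega>. (X \<omega>, Y \<omega>)) \<in> plans (distr M borel X) (distr M borel Y)"
    by (intro law_in_plans M siX siY)
  have cost: "(\<integral>(x1, x2). (norm (x1 - x2))\<^sup>2 \<partial>distr M borel (\<lambda>\<omega>. (X \<omega>, Y \<omega>))) = c"
    unfolding c_def by (rule cost_law) measurable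
  show W: "(W2 (distr M borel X) (distr M borel Y))\<^sup>2 = (\<integral>\<omega>. (norm (X \<omega> - Y \<omega>))\<^sup>2 \<partial>M)"
    using ge W2_square_le[OF XY] unfolding cost c_def by simp
  have XY_opt: "distr M borel (\<lambda>\<omega>. (X \<omega>, Y \<omega>)) \<in> opt_plans (distr M borel X) (distr M borel Y)"
    using XY ge cost by (intro opt_plansI) auto
  have unique: "\<gamma> = distr M borel (\<lambda>\<omega>. (X \<omega>, Y \<omega>))" if \<gamma>: "\<gamma> \<in> opt_plans (distr M borel X) (distr M borel Y)" for \<gamma>
  proof -
    have \<gamma>p: "\<gamma> \<in> plans (distr M borel X) (distr M borel Y)" and opt: "(\<integral>z. (norm (fst z - snd z))\<^sup>2 \<partial>\<gamma>) = c"
      using \<gamma> by (simp_all add: opt_plans_def W c_def case_prod_beta')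
    note pl = plan[OF \<gamma>p] and [measurable_cong] = plansD(2)[OF \<gamma>p]
    have [measurable]: "fst \<in> borel_measurable \<gamma>" "snd \<in> borel_measurable \<gamma>" by (fact pl)+
    \<comment> \<open>The nearest-point map; the choice of preimage is immaterial because \<open>X\<close> is a function of \<open>Y\<close>.\<close>
    define T where "T y = (if y \<in> R then X (SOME \<omega>. \<omega> \<in> space M \<and> Y \<omega> = y) else 0)" for y
    have [measurable]: "T \<in> borel_measurable borel"
      by (rule measurable_discrete_difference[where f="\<lambda>_. 0" and X=R]) (auto simp: T_def R countable_finite)
    have T: "T (Y \<omega>) = X \<omega>" if "\<omega> \<in> space M" for \<omega>
    proof -
      define \<omega>' where "\<omega>' = (SOME \<omega>'. \<omega>' \<in> space M \<and> Y \<omega>' = Y \<omega>)"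
      have \<omega>': "\<omega>' \<in> space M \<and> Y \<omega>' = Y \<omega>" unfolding \<omega>'_def by (rule someI[of _ \<omega>]) (simp add: that)
      \<comment> \<open>If \<open>Y\<close> agrees at two sample points where \<open>X\<close> differs, each value of \<open>X\<close> would be strictly nearer than the other.\<close>
      have "X \<omega>' = X \<omega>"
        using near[of \<omega> \<omega>'] near[of \<omega>' \<omega>] that \<omega>' by (metis order_less_asym)
      then show ?thesis using that by (simp add: T_def R_def \<omega>'_def)
    qed
    have "(\<integral>z. (norm (fst z - snd z))\<^sup>2 - d (snd z) \<partial>\<gamma>) = 0"
      using pl opt by simp
    then have "AE z in \<gamma>. (norm (fst z - snd z))\<^sup>2 - d (snd z) = 0"
      using pl by (subst (asm) integral_nonneg_eq_0_iff_AE) auto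
    then have eq: "AE z in \<gamma>. fst z = T (snd z)"
      using pl(1,2)
    proof eventually_elim
      case (elim z)
      then obtain \<omega> \<omega>' where \<omega>: "\<omega> \<in> space M" "snd z = Y \<omega>" "\<omega>' \<in> space M" "fst z = X \<omega>'"
        by (auto simp: S_def R_def)
      then have "dist (Y \<omega>) (X \<omega>') = dist (Y \<omega>) (X \<omega>)"
        using elim(1) d_Y[of \<omega>] by (simp add: dist_norm norm_minus_commute)
      then have "X \<omega>' = X \<omega>" using near[of \<omega> \<omega>'] \<omega> by force
      then show ?case using \<omega> T by simp
    qed
    have "\<gamma> = distr \<gamma> borel (\<lambda>z. (fst z, snd z))" using plan_as_law[OF \<gamma>p] by simp
    also have "\<dots> = distr \<gamma> borel (\<lambda>z. (T (snd z), snd z))"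
      by (intro distr_cong_AE) (use eq in auto)
    also have "\<dots> = distr (distr \<gamma> borel snd) borel (\<lambda>y. (T y, y))"
      by (simp add: distr_distr o_def)
    also have "\<dots> = distr M borel (\<lambda>\<omega>. (T (Y \<omega>), Y \<omega>))"
      unfolding plansD(6)[OF \<gamma>p] by (simp add: distr_distr o_def)
    also have "\<dots> = distr M borel (\<lambda>\<omega>. (X \<omega>, Y \<omega>))"
      by (intro distr_cong) (auto simp: T)
    finally show ?thesis .
  qed
  show "opt_plans (distr M borel X) (distr M borel Y) = {distr M borel (\<lambda>\<omega>. (X \<omega>, Y \<omega>))}"
    using XY_opt unique by blast
qed

section \<open>Particles in uniform motion\<close>

text \<open>If the inequality fails, subtract the right-hand side and add a small convex parabola \<open>h t * s * (s - 1)\<close>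
  vanishing at the end points. The result \<open>g\<close> still has a positive maximum in the interior, but there it is
  supported from below by a strictly convex parabola; on the side where the slope \<open>D'\<close> of that parabola does not decrease, \<open>g\<close>
  exceeds its maximum.\<close>

lemma convex_if_locally_supported:
  fixes f :: "real \<Rightarrow> real"
  assumes cont: "continuous_on {0..1} f"
    and supp: "\<And>t. t \<in> {0<..<1} \<Longrightarrow> \<exists>D. \<exists>\<eta>>0. \<forall>s. \<bar>s - t\<bar> < \<eta> \<longrightarrow> f t + D * (s - t) + k * (s - t)\<^sup>2 \<le> f s"
    and t: "t \<in> {0..1}"
  shows "f t \<le> (1 - t) * f 0 + t * f 1 - k * t * (1 - t)"
proof (rule ccontr)
  define h where "h s = f s - (1 - s) * f 0 - s * f 1 + k * s * (1 - s)" for s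
  assume "\<not> f t \<le> (1 - t) * f 0 + t * f 1 - k * t * (1 - t)"
  then have ht: "h t > 0" by (simp add: h_def)
  define g where "g s = h s - h t * s * (1 - s)" for s
  have "continuous_on {0..1} g"
    unfolding g_def h_def by (intro continuous_intros cont)
  then obtain m where m: "m \<in> {0..1}" "\<And>s. s \<in> {0..1} \<Longrightarrow> g s \<le> g m"
    using continuous_attains_sup[of "{0..1::real}" g] by auto
  have "t * (1 - t) \<le> 1 * (1 - t)" using t by (intro mult_right_mono) auto
  then have "t * (1 - t) < 1" 
    using t by (cases "t = 0") auto
  then have "g t > 0" using mult_strict_left_mono[of "t * (1 - t)" 1 "h t"] ht by (simp add: g_def mult.assoc)
  then have "g m > 0" using m(2)[OF t] by simp
  moreover have "g 0 = 0" "g 1 = 0" by (simp_all add: g_def h_def)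
  ultimately have "m \<noteq> 0" "m \<noteq> 1" by auto
  then have m01: "0 < m" "m < 1" using m(1) by auto
  then obtain D \<eta> where \<eta>: "\<eta> > 0" and D: "\<And>s. \<bar>s - m\<bar> < \<eta> \<Longrightarrow> f m + D * (s - m) + k * (s - m)\<^sup>2 \<le> f s"
    using supp[of m] by auto
  define D' where "D' = D + f 0 - f 1 + (k - h t) * (1 - 2 * m)"
  define r where "r = min (\<eta> / 2) (min m (1 - m))"
  have r: "r > 0" "r < \<eta>" "r \<le> m" "r \<le> 1 - m" using \<eta> m01 by (auto simp: r_def)
  define s where "s = (if D' \<ge> 0 then m + r else m - r)"
  have s: "\<bar>s - m\<bar> < \<eta>" "s \<in> {0..1}" "D' * (s - m) \<ge> 0" "(s - m)\<^sup>2 > 0"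
    using r by (auto simp: s_def mult_nonpos_nonneg)
  have "g s - g m - D' * (s - m) - h t * (s - m)\<^sup>2 = f s - f m - D * (s - m) - k * (s - m)\<^sup>2"
    unfolding g_def h_def[of s] h_def[of m] D'_def by (simp add: algebra_simps power2_eq_square)
  then have "g s \<ge> g m + D' * (s - m) + h t * (s - m)\<^sup>2" using D[OF s(1)] by simp
  moreover have "h t * (s - m)\<^sup>2 > 0" using ht s(4) by simp
  ultimately show False using m(2)[OF s(2)] s(3) by linarith
qed

lemma finite_set_separated:
  fixes S :: "'a::metric_space set"
  assumes "finite S"
  obtains \<delta> where "\<delta> > 0" "\<And>p q. p \<in> S \<Longrightarrow> q \<in> S \<Longrightarrow> p \<noteq> q \<Longrightarrow> \<delta> \<le> dist p q"
proof -
  have "finite ((\<lambda>(p, q). dist p q) ` (S \<times> S))" using assms by simp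
  from finite_set_avoid[OF this, of 0] obtain \<delta> where \<delta>: "\<delta> > 0"
    "\<forall>x\<in>(\<lambda>(p, q). dist p q) ` (S \<times> S). x \<noteq> 0 \<longrightarrow> \<delta> \<le> dist 0 x" by blast
  then have "\<delta> \<le> dist p q" if "p \<in> S" "q \<in> S" "p \<noteq> q" for p q
    using that by (force simp: dist_real_def)
  then show ?thesis using that \<delta>(1) by blast
qed

text \<open>Finitely many particles, given by the values of the pair \<open>(X, V)\<close>, start in \<open>X\<close> and move with constant
  velocity \<open>V\<close>. Particles may share a position and may collide.\<close>

locale simple_motion = prob_space M for M :: "'b measure" +
  fixes X V :: "'b \<Rightarrow> 'a::euclidean_space"
  assumes X: "simple_function M X" and V: "simple_function M V"
begin

definition pos :: "real \<Rightarrow> 'b \<Rightarrow> 'a" where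
  "pos t \<omega> = X \<omega> + t *\<^sub>R V \<omega>"

definition law :: "real \<Rightarrow> 'a measure" where
  "law t = distr M borel (pos t)"

definition energy :: real where
  "energy = (\<integral>\<omega>. (norm (V \<omega>))\<^sup>2 \<partial>M)"

lemma simple_pos: "simple_function M (pos t)"
  using simple_function_compose2[OF X V, of "\<lambda>x v. x + t *\<^sub>R v"] by (simp add: pos_def[abs_def])

lemma pos_measurable [measurable]: "pos t \<in> borel_measurable M"
  using simple_pos by (rule borel_measurable_simple_function)

lemma law_P2: "law t \<in> P2"
  unfolding law_def by (intro law_in_P2 simple_function_square_integrable simple_pos prob_space_axioms)

lemma pos_convex_combination: "(1 - r) *\<^sub>R pos t \<omega> + r *\<^sub>R pos s \<omega> = pos (t + r * (s - t)) \<omega>"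
  by (simp add: pos_def algebra_simps)

lemma velocity_bounded: obtains K where "K > 0" "\<And>\<omega>. \<omega> \<in> space M \<Longrightarrow> norm (V \<omega>) \<le> K"
proof -
  obtain K where "K > 0" "\<forall>v\<in>V ` space M. norm v \<le> K"
    using finite_imp_bounded[OF simple_functionD(1)[OF V]] unfolding bounded_pos by blast
  then show ?thesis by (intro that[of K]) auto
qed

text \<open>The bound on the displacement in terms of the separation \<open>\<delta>\<close> of the positions at time \<open>t\<close> is what makes every
  particle's old position the unique nearest one.\<close>

lemma unique_optimal_plan:
  obtains \<eta> where "\<eta> > 0"
    "\<And>s. \<bar>s - t\<bar> < \<eta> \<Longrightarrow> opt_plans (law t) (law s) = {distr M borel (\<lambda>\<omega>. (pos t \<omega>, pos s \<omega>))}"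
    "\<And>s. \<bar>s - t\<bar> < \<eta> \<Longrightarrow> W2 (law t) (law s) = \<bar>s - t\<bar> * sqrt energy"
proof -
  obtain \<delta> where \<delta>: "\<delta> > 0" 
    "\<And>p q. p \<in> pos t ` space M \<Longrightarrow> q \<in> pos t ` space M \<Longrightarrow> p \<noteq> q \<Longrightarrow> \<delta> \<le> dist p q"
    by (rule finite_set_separated[OF simple_functionD(1)[OF simple_pos]]) blast
  obtain K where K: "K > 0" "\<And>\<omega>. \<omega> \<in> space M \<Longrightarrow> norm (V \<omega>) \<le> K" by (rule velocity_bounded) blast
  have step: "pos s \<omega> - pos t \<omega> = (s - t) *\<^sub>R V \<omega>" for s \<omega> by (simp add: pos_def algebra_simps)
  have near: "dist (pos s \<omega>) (pos t \<omega>) < dist (pos s \<omega>) (pos t \<omega>')"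
    if "\<bar>s - t\<bar> < \<delta> / (2 * K)" "\<omega> \<in> space M" "\<omega>' \<in> space M" "pos t \<omega> \<noteq> pos t \<omega>'" for s \<omega> \<omega>'
  proof -
    have "dist (pos s \<omega>) (pos t \<omega>) = \<bar>s - t\<bar> * norm (V \<omega>)"
      by (simp add: dist_norm step)
    also have "\<dots> \<le> \<bar>s - t\<bar> * K" using K(2)[OF that(2)] by (intro mult_left_mono) auto
    also have "\<dots> < \<delta> / 2" using that(1) K(1) by (simp add: field_simps)
    finally have "dist (pos s \<omega>) (pos t \<omega>) < \<delta> / 2" .
    moreover have "\<delta> \<le> dist (pos t \<omega>) (pos t \<omega>')" by (intro \<delta>(2) imageI that)
    ultimately show ?thesis
      using dist_triangle2[of "pos t \<omega>" "pos t \<omega>'" "pos s \<omega>"] dist_commute[of "pos t \<omega>'" "pos s \<omega>"]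
        dist_commute[of "pos t \<omega>" "pos s \<omega>"] by linarith
  qed
  show ?thesis
  proof
    show "\<delta> / (2 * K) > 0" using \<delta>(1) K(1) by simp
    fix s assume s: "\<bar>s - t\<bar> < \<delta> / (2 * K)"
    note plan = nearest_point_plan[OF prob_space_axioms simple_pos simple_pos near[OF s], folded law_def]
    show "opt_plans (law t) (law s) = {distr M borel (\<lambda>\<omega>. (pos t \<omega>, pos s \<omega>))}"
      by (rule plan)
    have "(W2 (law t) (law s))\<^sup>2 = (\<integral>\<omega>. (norm (pos t \<omega> - pos s \<omega>))\<^sup>2 \<partial>M)"
      by (rule plan)
    also have "\<dots> = (\<integral>\<omega>. \<bar>s - t\<bar>\<^sup>2 * (norm (V \<omega>))\<^sup>2 \<partial>M)"
      by (simp add: norm_minus_commute[of "pos t _"] step power_mult_distrib)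
    also have "\<dots> = \<bar>s - t\<bar>\<^sup>2 * energy" by (simp add: energy_def)
    finally have "sqrt ((W2 (law t) (law s))\<^sup>2) = \<bar>s - t\<bar> * sqrt energy" by (simp add: real_sqrt_mult)
    moreover have "W2 (law t) (law s) \<ge> 0"
      by (intro W2_nonneg plans_nonempty law_P2)
    ultimately show "W2 (law t) (law s) = \<bar>s - t\<bar> * sqrt energy" by simp
  qed
qed

lemma energy_nonneg: "0 \<le> energy"
  unfolding energy_def by (rule Bochner_Integration.integral_nonneg) simp

text \<open>Compare \<open>t\<close>, \<open>s\<close> and an intermediate time \<open>u = t + r (s - t)\<close>. Geodesic convexity on the segment bounds \<open>F (law u)\<close>
  from above in terms of both end points, since the plan along the motion is the only one available to it. Differentiability at
  \<open>t\<close> bounds \<open>F (law u)\<close> from below by the linear expansion with slope \<open>D\<close>. Dividing by \<open>r\<close> and choosing \<open>r\<close>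
  small gives the claim at \<open>s\<close> up to \<open>e\<close>; the slope is the same on both sides of \<open>t\<close>.\<close>

lemma local_support:
  fixes F :: "'a measure \<Rightarrow> real"
  assumes conv: "geodesically_convex l F" and diff: "W2_differentiable F (law t)"
  shows "\<exists>D. \<exists>\<eta>>0. \<forall>s. \<bar>s - t\<bar> < \<eta> \<longrightarrow>
    F (law t) + D * (s - t) + l / 2 * energy * (s - t)\<^sup>2 \<le> F (law s)"
proof -
  obtain \<xi> where "\<xi> \<in> W2_diff F (law t)" using diff by (auto simp: W2_differentiable_def)
  then have \<xi>: "\<xi> \<in> borel_measurable (law t)"
    and diff: "\<And>\<epsilon>. \<epsilon> > 0 \<Longrightarrow> \<exists>\<delta>>0. \<forall>\<nu>\<in>P2. W2 (law t) \<nu> < \<delta> \<longrightarrow> (\<forall>\<gamma>\<in>opt_plans (law t) \<nu>.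
        \<bar>F \<nu> - F (law t) - (\<integral>(x1, x2). \<xi> x1 \<bullet> (x2 - x1) \<partial>\<gamma>)\<bar> \<le> \<epsilon> * W2 (law t) \<nu>)"
    unfolding W2_diff_def L2_def by blast+
  have [measurable]: "\<xi> \<in> borel_measurable borel" using \<xi> by (simp add: law_def)
  define D where "D = (\<integral>\<omega>. \<xi> (pos t \<omega>) \<bullet> V \<omega> \<partial>M)"
  obtain \<eta> where \<eta>: "\<eta> > 0" and
    opt: "\<And>s. \<bar>s - t\<bar> < \<eta> \<Longrightarrow> opt_plans (law t) (law s) = {distr M borel (\<lambda>\<omega>. (pos t \<omega>, pos s \<omega>))}" and
    W2: "\<And>s. \<bar>s - t\<bar> < \<eta> \<Longrightarrow> W2 (law t) (law s) = \<bar>s - t\<bar> * sqrt energy"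
    by (rule unique_optimal_plan[of t]) blast
  have slope: "(\<integral>(x1, x2). \<xi> x1 \<bullet> (x2 - x1) \<partial>distr M borel (\<lambda>\<omega>. (pos t \<omega>, pos s \<omega>))) = (s - t) * D" for s
  proof -
    have "(\<integral>(x1, x2). \<xi> x1 \<bullet> (x2 - x1) \<partial>distr M borel (\<lambda>\<omega>. (pos t \<omega>, pos s \<omega>))) = 
        (\<integral>\<omega>. \<xi> (pos t \<omega>) \<bullet> (pos s \<omega> - pos t \<omega>) \<partial>M)"
      unfolding case_prod_beta' by (subst integral_distr) auto
    also have "\<dots> = (\<integral>\<omega>. (s - t) * (\<xi> (pos t \<omega>) \<bullet> V \<omega>) \<partial>M)"
      by (intro Bochner_Integration.integral_cong) (auto simp: pos_def algebra_simps)
    finally show ?thesis by (simp add: D_def)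
  qed
  have "F (law t) + D * (s - t) + l / 2 * energy * (s - t)\<^sup>2 \<le> F (law s)" if s: "\<bar>s - t\<bar> < \<eta>" for s
  proof (rule field_le_epsilon)
    fix e :: real assume e: "e > 0"
    define b where "b = \<bar>s - t\<bar> * sqrt energy"
    define \<epsilon> where "\<epsilon> = e / (2 * (b + 1))"
    define c where "c = l / 2 * energy * (s - t)\<^sup>2"
    have b: "b \<ge> 0" using energy_nonneg by (simp add: b_def)
    have \<epsilon>: "\<epsilon> > 0" "\<epsilon> * b \<le> e / 2" using e b by (auto simp: \<epsilon>_def field_simps)
    from diff[OF \<epsilon>(1)] obtain \<delta> where \<delta>: "\<delta> > 0" and
      D: "\<And>\<nu> \<gamma>. \<nu> \<in> P2 \<Longrightarrow> W2 (law t) \<nu> < \<delta> \<Longrightarrow> \<gamma> \<in> opt_plans (law t) \<nu> \<Longrightarrow>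
        \<bar>F \<nu> - F (law t) - (\<integral>(x1, x2). \<xi> x1 \<bullet> (x2 - x1) \<partial>\<gamma>)\<bar> \<le> \<epsilon> * W2 (law t) \<nu>"
      by blast
    \<comment> \<open>Small enough for \<open>u\<close> to be in the range of the expansion and for \<open>r * c\<close> to be at most \<open>e / 2\<close>.\<close>
    define r where "r = min (1 / 2) (min (\<delta> / (2 * (b + 1))) (e / (2 * (\<bar>c\<bar> + 1))))"
    have r: "0 < r" "r < 1" using \<delta> b e by (auto simp: r_def)
    have rb: "r * b < \<delta>"
    proof -
      have "r * b \<le> \<delta> / (2 * (b + 1)) * b" using b by (intro mult_right_mono) (auto simp: r_def)
      also have "\<dots> < \<delta>" using b \<delta> by (simp add: field_simps add_nonneg_pos)
      finally show ?thesis .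
    qed
    define u where "u = t + r * (s - t)"
    have ut: "\<bar>u - t\<bar> = r * \<bar>s - t\<bar>" using r by (simp add: u_def abs_mult)
    also have "\<dots> \<le> \<bar>s - t\<bar>" using r by (intro mult_left_le_one_le) auto
    finally have u: "\<bar>u - t\<bar> < \<eta>" using s by simp
    have Wu: "W2 (law t) (law u) = r * b" using W2[OF u] ut by (simp add: b_def)
    have "\<bar>F (law u) - F (law t) - (u - t) * D\<bar> \<le> \<epsilon> * W2 (law t) (law u)"
      using D[OF law_P2, of u] rb opt[OF u] by (simp add: Wu slope)
    moreover have "u - t = r * (s - t)" by (simp add: u_def)
    ultimately have lower: "F (law u) \<ge> F (law t) + r * (s - t) * D - r * (\<epsilon> * b)"
      unfolding Wu by (simp add: abs_le_iff mult.left_commute)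
    obtain m where "geodesic_between (law t) (law s) m" and
      m: "\<And>r. r \<in> {0..1} \<Longrightarrow> F (m r) \<le> (1 - r) * F (law t) + r * F (law s) - l / 2 * r * (1 - r) * (W2 (law t) (law s))\<^sup>2"
      using conv law_P2 unfolding geodesically_convex_def by blast
    then have "m r = distr (distr M borel (\<lambda>\<omega>. (pos t \<omega>, pos s \<omega>))) borel (\<lambda>(x1, x2). (1 - r) *\<^sub>R x1 + r *\<^sub>R x2)"
      using r unfolding geodesic_between_def opt[OF s] by auto
    also have "\<dots> = law u"
      unfolding law_def u_def case_prod_beta' by (simp add: distr_distr o_def pos_convex_combination[abs_def] cong: distr_cong)
    finally have "F (law u) \<le> (1 - r) * F (law t) + r * F (law s) - l / 2 * r * (1 - r) * (W2 (law t) (law s))\<^sup>2"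
      using m[of r] r by simp
    also have "(W2 (law t) (law s))\<^sup>2 = (s - t)\<^sup>2 * energy"
      using energy_nonneg by (simp add: W2[OF s] power_mult_distrib)
    finally have upper: "F (law u) \<le> (1 - r) * F (law t) + r * F (law s) - r * (c - r * c)"
      by (simp add: c_def algebra_simps diff_divide_distrib)
    have "r * (F (law t) + D * (s - t) + c - r * c - \<epsilon> * b) \<le> r * F (law s)"
      using lower upper by (simp add: algebra_simps)
    then have "F (law t) + D * (s - t) + c - r * c - \<epsilon> * b \<le> F (law s)"
      using r by simp
    moreover have "r * c \<le> e / 2"
    proof -
      have "r * \<bar>c\<bar> \<le> e / (2 * (\<bar>c\<bar> + 1)) * \<bar>c\<bar>" by (intro mult_right_mono) (auto simp: r_def)
      also have "\<dots> \<le> e / 2" using e by (simp add: field_simps)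
      finally show ?thesis using r mult_left_mono[OF abs_ge_self[of c], of r] by linarith
    qed
    ultimately show "F (law t) + D * (s - t) + l / 2 * energy * (s - t)\<^sup>2 \<le> F (law s) + e"
      using \<epsilon>(2) by (simp add: c_def)
  qed
  then show ?thesis using \<eta> by blast
qed

lemma continuous_along:
  fixes F :: "'a measure \<Rightarrow> real"
  assumes F: "\<forall>\<mu>\<in>P2. W2_differentiable F \<mu>"
  shows "continuous_on {0..1} (\<lambda>t. F (law t))"
proof (rule continuous_on_sequentiallyI)
  fix u :: "nat \<Rightarrow> real" and t assume u: "\<forall>n. u n \<in> {0..1}" "u \<longlonglongrightarrow> t"
  have si: "square_integrable M X" "square_integrable M V"
    by (intro simple_function_square_integrable X V prob_space_axioms)+
  show "(\<lambda>n. F (law (u n))) \<longlonglongrightarrow> F (law t)"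
    unfolding law_def
  proof (rule W2_differentiable_imp_tendsto_law[OF prob_space_axioms F])
    show "AE \<omega> in M. (\<lambda>n. pos (u n) \<omega>) \<longlonglongrightarrow> pos t \<omega>"
      unfolding pos_def by (intro AE_I2 tendsto_intros u)
    show "AE \<omega> in M. (norm (pos (u n) \<omega>))\<^sup>2 \<le> 2 * (norm (X \<omega>))\<^sup>2 + 2 * (norm (V \<omega>))\<^sup>2" for n
    proof (rule AE_I2)
      fix \<omega>
      have "(u n * norm (V \<omega>))\<^sup>2 \<le> (1 * norm (V \<omega>))\<^sup>2" 
        using u(1) by (intro power_mono mult_right_mono mult_nonneg_nonneg) auto
      then show "(norm (pos (u n) \<omega>))\<^sup>2 \<le> 2 * (norm (X \<omega>))\<^sup>2 + 2 * (norm (V \<omega>))\<^sup>2"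
        using norm_add_square_le[of "X \<omega>" "u n *\<^sub>R V \<omega>"] u(1) by (simp add: pos_def power_mult_distrib)
    qed
    show "integrable M (\<lambda>\<omega>. 2 * (norm (X \<omega>))\<^sup>2 + 2 * (norm (V \<omega>))\<^sup>2)"
      using si by (simp add: square_integrable_def)
  qed measurable
qed

lemma convex_along:
  fixes F :: "'a measure \<Rightarrow> real"
  assumes "\<forall>\<mu>\<in>P2. W2_differentiable F \<mu>" "geodesically_convex l F" "t \<in> {0..1}"
  shows "F (law t) \<le> (1 - t) * F (law 0) + t * F (law 1) - l / 2 * energy * t * (1 - t)"
  using assms(1) law_P2
  by (intro convex_if_locally_supported[where f="\<lambda>t. F (law t)"] continuous_along local_support assms) auto

end

section \<open>The equivalence\<close>

text \<open>Both coordinates of the plan are approximated by simple functions with a square-integrable bound. The convexity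
  inequality for the approximations passes to the limit because \<open>F\<close> is continuous.\<close>

lemma geodesically_imp_acceleration_free:
  fixes F :: "'a::euclidean_space measure \<Rightarrow> real"
  assumes F: "\<forall>\<mu>\<in>P2. W2_differentiable F \<mu>" and conv: "geodesically_convex l F"
  shows "acceleration_free_convex l F"
  unfolding acceleration_free_convex_def
proof (intro ballI)
  fix \<mu>1 \<mu>2 :: "'a measure" and \<gamma> t
  assume \<gamma>: "\<gamma> \<in> plans \<mu>1 \<mu>2" and t: "t \<in> {0..1::real}"
  note pl = plansD[OF \<gamma>]
  interpret \<gamma>: prob_space \<gamma> by (rule pl)
  have m: "fst \<in> borel_measurable \<gamma>" "snd \<in> borel_measurable \<gamma>"
    using pl(3,4) by (simp_all add: square_integrable_def)
  obtain X where X: "\<And>n. simple_function \<gamma> (X n)" "\<And>z. z \<in> space \<gamma> \<Longrightarrow> (\<lambda>n. X n z) \<longlonglongrightarrow> fst z"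
    "\<And>n z. z \<in> space \<gamma> \<Longrightarrow> norm (X n z) \<le> 2 * norm (fst z)"
    using borel_measurable_implies_sequence_metric[OF m(1), of 0] unfolding norm_conv_dist by blast
  obtain Y where Y: "\<And>n. simple_function \<gamma> (Y n)" "\<And>z. z \<in> space \<gamma> \<Longrightarrow> (\<lambda>n. Y n z) \<longlonglongrightarrow> snd z"
    "\<And>n z. z \<in> space \<gamma> \<Longrightarrow> norm (Y n z) \<le> 2 * norm (snd z)"
    using borel_measurable_implies_sequence_metric[OF m(2), of 0] unfolding norm_conv_dist by blast
  have XY_meas: "X n \<in> borel_measurable \<gamma>" "Y n \<in> borel_measurable \<gamma>" for n
    using X(1) Y(1) by (auto intro: borel_measurable_simple_function)
  have comb_meas: "(\<lambda>z. a *\<^sub>R X n z + b *\<^sub>R Y n z) \<in> borel_measurable \<gamma>" 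
    "(\<lambda>z. a *\<^sub>R fst z + b *\<^sub>R snd z) \<in> borel_measurable \<gamma>" for a b n
    by (intro borel_measurable_add borel_measurable_scaleR borel_measurable_const m XY_meas)+
  define g where "g z = 8 * (norm (fst z))\<^sup>2 + 8 * (norm (snd z))\<^sup>2" for z :: "'a \<times> 'a"
  have g: "integrable \<gamma> g" unfolding g_def[abs_def] using pl(3,4) by (simp add: square_integrable_def)
  have dom: "AE z in \<gamma>. (norm (a *\<^sub>R X n z + b *\<^sub>R Y n z))\<^sup>2 \<le> g z" if "\<bar>a\<bar> \<le> 1" "\<bar>b\<bar> \<le> 1" for a b n
  proof (rule AE_I2)
    fix z assume z: "z \<in> space \<gamma>"
    have *: "(norm (a *\<^sub>R x))\<^sup>2 \<le> 4 * (norm y)\<^sup>2" if "\<bar>a\<bar> \<le> 1" "norm x \<le> 2 * norm y" for a and x y :: 'a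
    proof -
      have "norm (a *\<^sub>R x) \<le> 1 * norm x" unfolding norm_scaleR using that(1) by (intro mult_right_mono) auto
      then have "(norm (a *\<^sub>R x))\<^sup>2 \<le> (2 * norm y)\<^sup>2" using that(2) by (intro power_mono) auto
      then show ?thesis by (simp add: power_mult_distrib)
    qed
    show "(norm (a *\<^sub>R X n z + b *\<^sub>R Y n z))\<^sup>2 \<le> g z"
      using norm_add_square_le[of "a *\<^sub>R X n z" "b *\<^sub>R Y n z"] *[OF that(1) X(3)[OF z, of n]] *[OF that(2) Y(3)[OF z, of n]]
      by (simp add: g_def)
  qed
  have lim: "AE z in \<gamma>. (\<lambda>n. a *\<^sub>R X n z + b *\<^sub>R Y n z) \<longlonglongrightarrow> a *\<^sub>R fst z + b *\<^sub>R snd z" for a b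
    by (intro AE_I2 tendsto_add tendsto_scaleR tendsto_const X(2) Y(2))
  have F_lim: "(\<lambda>n. F (distr \<gamma> borel (\<lambda>z. a *\<^sub>R X n z + b *\<^sub>R Y n z))) 
      \<longlonglongrightarrow> F (distr \<gamma> borel (\<lambda>z. a *\<^sub>R fst z + b *\<^sub>R snd z))" if "\<bar>a\<bar> \<le> 1" "\<bar>b\<bar> \<le> 1" for a b
    by (rule W2_differentiable_imp_tendsto_law[OF \<gamma>.prob_space_axioms F comb_meas lim dom[OF that] g])
  define c where "c n = (\<integral>z. (norm (1 *\<^sub>R X n z + (- 1) *\<^sub>R Y n z))\<^sup>2 \<partial>\<gamma>)" for n
  define c' where "c' = (\<integral>z. (norm (1 *\<^sub>R fst z + (- 1) *\<^sub>R snd z))\<^sup>2 \<partial>\<gamma>)"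
  have c_lim: "c \<longlonglongrightarrow> c'"
    unfolding c_def[abs_def] c'_def
    by (rule square_integrable_dominated(3)[OF comb_meas lim dom g]) auto
  \<comment> \<open>The end points are written as trivial combinations so that one limit lemma serves all three measures.\<close>
  have approx: "F (distr \<gamma> borel (\<lambda>z. (1 - t) *\<^sub>R X n z + t *\<^sub>R Y n z)) \<le>
    (1 - t) * F (distr \<gamma> borel (\<lambda>z. 1 *\<^sub>R X n z + 0 *\<^sub>R Y n z)) + t * F (distr \<gamma> borel (\<lambda>z. 0 *\<^sub>R X n z + 1 *\<^sub>R Y n z))
    - l / 2 * c n * t * (1 - t)" for n
  proof -
    \<comment> \<open>Each value of the pair \<open>(X n, Y n)\<close> is a particle that travels from its first to its second component in unit time.\<close>
    interpret simple_motion \<gamma> "X n" "\<lambda>z. Y n z - X n z"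
      by unfold_locales (rule X(1), rule simple_function_diff[OF Y(1) X(1)])
    have "pos s = (\<lambda>z. (1 - s) *\<^sub>R X n z + s *\<^sub>R Y n z)" for s
      by (auto simp: pos_def algebra_simps)
    moreover have "energy = c n"
      by (simp add: energy_def c_def norm_minus_commute)
    ultimately show ?thesis
      using convex_along[OF F conv t] by (simp add: law_def)
  qed
  have t': "\<bar>1 - t\<bar> \<le> 1" "\<bar>t\<bar> \<le> 1" using t by auto
  have rhs_lim: "(\<lambda>n. (1 - t) * F (distr \<gamma> borel (\<lambda>z. 1 *\<^sub>R X n z + 0 *\<^sub>R Y n z)) + t * F (distr \<gamma> borel (\<lambda>z. 0 *\<^sub>R X n z + 1 *\<^sub>R Y n z))
      - l / 2 * c n * t * (1 - t)) \<longlonglongrightarrow>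
    (1 - t) * F (distr \<gamma> borel (\<lambda>z. 1 *\<^sub>R fst z + 0 *\<^sub>R snd z)) + t * F (distr \<gamma> borel (\<lambda>z. 0 *\<^sub>R fst z + 1 *\<^sub>R snd z))
      - l / 2 * c' * t * (1 - t)"
    by (intro tendsto_diff tendsto_add tendsto_mult tendsto_const c_lim F_lim) auto
  have "F (distr \<gamma> borel (\<lambda>z. (1 - t) *\<^sub>R fst z + t *\<^sub>R snd z)) \<le>
    (1 - t) * F (distr \<gamma> borel (\<lambda>z. 1 *\<^sub>R fst z + 0 *\<^sub>R snd z)) + t * F (distr \<gamma> borel (\<lambda>z. 0 *\<^sub>R fst z + 1 *\<^sub>R snd z))
    - l / 2 * c' * t * (1 - t)"
    by (rule LIMSEQ_le[OF F_lim[OF t'] rhs_lim]) (use approx in blast)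
  moreover have "(\<lambda>z. fst z) = fst" "(\<lambda>z. snd z) = snd" by auto
  ultimately show "F (distr \<gamma> borel (\<lambda>(x1, x2). (1 - t) *\<^sub>R x1 + t *\<^sub>R x2)) \<le>
          (1 - t) * F \<mu>1 + t * F \<mu>2 - l / 2 * t * (1 - t) * (\<integral>(x1, x2). (norm (x1 - x2))\<^sup>2 \<partial>\<gamma>)"
    unfolding case_prod_beta' by (simp add: pl(5,6) c'_def mult.commute mult.left_commute)
qed

theorem theorem1p1:
  fixes F :: "(real ^ 'd) measure \<Rightarrow> real" and l :: real
  assumes "\<forall>\<mu>\<in>P2. W2_differentiable F \<mu>"
  shows "(geodesically_convex l F \<longleftrightarrow> generalised_geodesically_convex l F) \<and>
         (generalised_geodesically_convex l F \<longleftrightarrow> acceleration_free_convex l F)"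
  using geodesically_imp_acceleration_free[OF assms] acceleration_free_imp_generalised generalised_imp_geodesically
  by blast

end
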